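(* Let $F=(f_1,\ldots,f_k):\mathbb{A}^n\to\mathbb{A}^k$, $n\ge k$, be a real, complex or mixed polynomial mapping with non-constant components, depending effectively on all the variables, such that $F(0)=0$. If $F$ is non-degenerate at infinity, then $$B(F)\subset F(\operatorname{Sing}F)\cup N(F)\cup A(F).$$
   Context: **Mappings.** $F=(f_1,\ldots,f_k):\mathbb{A}^n\to\mathbb{A}^k$ is of one of three types: real ($\mathbb{A}=\mathbb{R}$, $f_j$ real polynomials), complex ($\mathbb{A}=\mathbb{C}$, $f_j$ complex polynomials in $z$), or mixed ($\mathbb{A}=\mathbb{C}$, $f_j$ polynomials in $z$ and $\bar z$ with complex coefficients). $\mathbb{A}^*=\mathbb{A}\setminus\{0\}$. For a map, $\operatorname{Sing}$ denotes the set of points where the differential is not surjective; for mixed maps this is the real differential of the underlying real map ($\mathbb{C}=\mathbb{R}^2$). $F$ *depends effectively on all the variables* if for every variable $z_i$ some $f_j$ depends effectively on $z_i$. **Bifurcation locus.** $B(F)\subset\mathbb{A}^k$ is the minimal set of points such that the restriction $F_|:F^{-1}(\mathbb{A}^k\setminus B(F))\to\mathbb{A}^k\setminus B(F)$ is a locally trivial fibration. **Supports and Newton polyhedra.** For $f(x)=\sum_\nu c_\nu x^\nu$ put $\operatorname{supp}(f)=\{\nu\in\mathbb{N}^n: c_\nu\ne0\}$; for mixed $f(z,\bar z)=\sum_{\nu,\mu}c_{\nu,\mu}z^\nu\bar z^\mu$ put $\operatorname{supp}(f)=\{\nu+\mu: c_{\nu,\mu}\neq0\}$. When $f(0)=0$,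 $\Gamma_0(f)$ is the convex hull of $\{0\}\cup\operatorname{supp}(f)$. For a face $\Delta$ (of any dimension), $f_\Delta=\sum_{\nu\in\Delta\cap\operatorname{supp}(f)}c_\nu x^\nu$, resp. $f_\Delta=\sum_{\nu+\mu\in\Delta\cap\operatorname{supp}(f)}c_{\nu,\mu}z^\nu\bar z^\mu$ in the mixed case. **Dual subdivision.** For $\mathbf{p}=(p_1,\ldots,p_n)\in\mathbb{Z}^n$ with $\min_i p_i<0$, let $l_{\mathbf{p}}(v)=\sum_i p_iv_i$ and let $\Delta^j_{\mathbf{p}}$ be the maximal face of $\Gamma_0(f_j)$ on which $l_{\mathbf{p}}$ attains its minimum over $\Gamma_0(f_j)$. Declare $\mathbf{p}\sim\mathbf{p}'$ iff $\Delta^j_{\mathbf{p}}=\Delta^j_{\mathbf{p}'}$ for all $1\le j\le k$. The equivalence classes give a partition of $\mathbb{R}^n\setminus\mathbb{R}^n_+$ (where $\mathbb{R}_+^n$ is the set of vectors with all coordinates $\ge 0$) into finitely many locally closed cones; each is subdivided into finitely many convex polyhedral cones, and $\mathcal{C}(F)$ is the finite set of cones obtained. For $\sigma\in\mathcal{C}(F)$, write $\Delta^j_\sigma:=\Delta^j_{\mathbf{p}}$ for any $\mathbf{p}\in\sigma$ (independent of $\mathbf{p}$), and $$I_\sigma=\{j: 0\notin\Delta^j_\sigma\},\quad J_\sigma=\{j:\Delta^j_\sigma=\{0\}\},\quad I_\sigma^c=\{1,\ldots,k\}\setminus I_\sigma,$$ $$G_\sigma=\{x\in(\mathbb{A}^*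 )^n: f_{\Delta^j_\sigma}(x)=0\ \text{for all } j\in I_\sigma\},$$ where $f_{\Delta^j_\sigma}$ stands for $(f_j)_{\Delta^j_\sigma}$. **Non-degeneracy at infinity.** $F$ (with $F(0)=0$) is *non-degenerate at infinity* if for every $\sigma\in\mathcal{C}(F)$ with $I_\sigma\neq\emptyset$ and $J_\sigma=\emptyset$, one has $\operatorname{Sing}\,(f_{\Delta^j_\sigma})_{j\in I_\sigma}\cap G_\sigma=\emptyset$. **The set $N(F)$.** $N(F)=\bigcup_{\sigma\in\mathcal{C}(F),\,J_\sigma\ne\emptyset}N_\sigma$, where $N_\sigma=\{(z_1,\ldots,z_k)\in\mathbb{A}^k: z_j=0\ \text{for all } j\in J_\sigma\}$. **The set $A(F)$.** $A(F)=\bigcup_\sigma A_\sigma$ over all $\sigma\in\mathcal{C}(F)$ with $J_\sigma=\emptyset$ and $I^c_\sigma\neq\emptyset$. Here $F_\sigma:=(f_{\Delta^j_\sigma})_{j\in I_\sigma^c}:G_\sigma\to\mathbb{A}^{|I^c_\sigma|}$ (with $G_\sigma=(\mathbb{A}^* )^n$ if $I_\sigma=\emptyset$), $\operatorname{Disc}F_\sigma=F_\sigma(\operatorname{Sing}F_\sigma)$ is its set of critical values, and $A_\sigma=\pi_{I_\sigma^c}^{-1}(\operatorname{Disc}F_\sigma)\subset\mathbb{A}^k$, where $\pi_{J}:\mathbb{A}^k\to\mathbb{A}^{|J|}$ is the projection onto the coordinates indexed by $J$. *)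

theory Defs
  imports "HOL-Analysis.Analysis" "HOL-Library.Poly_Mapping" "HOL-Library.Disjoint_Sets"
begin

text \<open>
  A polynomial is a finitely supported family of coefficients indexed by a type \<open>'m\<close> of monomials.
  The real and complex cases (\<open>ordinary\<close>) and the mixed case (\<open>mixed\<close>) differ only in this index
  type: a monomial carries its exponent in \<open>\<nat>\<^sup>n\<close>, which is \<open>\<nu> + \<mu>\<close> for \<open>z\<^sup>\<nu> z\<bar>\<^sup>\<mu>\<close>, and the
  function that it denotes.
\<close>

record ('m, 'n, 'a) monomials =
  exponent :: "'m \<Rightarrow> nat ^ 'n"
  monom_fun :: "'m \<Rightarrow> 'a ^ 'n \<Rightarrow> 'a"

definition ordinary :: "(nat ^ 'n, 'n::finite, 'a::comm_monoid_mult) monomials" where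
  "ordinary = \<lparr>exponent = (\<lambda>\<nu>. \<nu>), monom_fun = (\<lambda>\<nu> x. \<Prod>i\<in>UNIV. (x $ i) ^ (\<nu> $ i))\<rparr>"

definition mixed :: "((nat ^ 'n) \<times> (nat ^ 'n), 'n::finite, complex) monomials" where
  "mixed = \<lparr>exponent = (\<lambda>(\<nu>, \<mu>). \<nu> + \<mu>),
            monom_fun = (\<lambda>(\<nu>, \<mu>) z. \<Prod>i\<in>UNIV. (z $ i) ^ (\<nu> $ i) * cnj (z $ i) ^ (\<mu> $ i))\<rparr>"

definition poly_fun ::
    "('m, 'n::finite, 'a) monomials \<Rightarrow> ('m \<Rightarrow>\<^sub>0 'a::comm_semiring_1) \<Rightarrow> 'a ^ 'n \<Rightarrow> 'a" where
  "poly_fun K f x = (\<Sum>m\<in>Poly_Mapping.keys f. Poly_Mapping.lookup f m * monom_fun K m x)"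

definition poly_map ::
    "('m, 'n::finite, 'a) monomials \<Rightarrow> ('k::finite \<Rightarrow> 'm \<Rightarrow>\<^sub>0 'a::comm_semiring_1) \<Rightarrow> 'a ^ 'n \<Rightarrow> 'a ^ 'k" where
  "poly_map K F x = (\<chi> j. poly_fun K (F j) x)"

definition depends_on_var :: "('a ^ 'n::finite \<Rightarrow> 'b) \<Rightarrow> 'n \<Rightarrow> bool" where
  "depends_on_var g i \<longleftrightarrow> (\<exists>x y. (\<forall>l. l \<noteq> i \<longrightarrow> x $ l = y $ l) \<and> g x \<noteq> g y)"

definition depends_on_all_vars ::
    "('m, 'n::finite, 'a) monomials \<Rightarrow> ('k \<Rightarrow> 'm \<Rightarrow>\<^sub>0 'a::comm_semiring_1) \<Rightarrow> bool" where
  "depends_on_all_vars K F \<longleftrightarrow> (\<forall>i. \<exists>j. depends_on_var (poly_fun K (F j)) i)"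

text \<open>
  Throughout, the differential is the real Frechet derivative; for a holomorphic map it is, as a
  map, the complex differential.
\<close>

definition Sing_map :: "('v::real_normed_vector \<Rightarrow> 'w::real_normed_vector) \<Rightarrow> 'v set" where
  "Sing_map F = {x. \<not> surj (frechet_derivative F (at x))}"

text \<open>
  Velocities at \<open>x\<close> of curves in \<open>M\<close>; for a smooth submanifold \<open>M\<close> this is its tangent space.
\<close>

definition tangent_space :: "'v::real_normed_vector set \<Rightarrow> 'v \<Rightarrow> 'v set" where
  "tangent_space M x =
     {v. \<exists>\<gamma>::real \<Rightarrow> 'v. \<gamma> 0 = x \<and> (\<forall>\<^sub>F t in nhds 0. \<gamma> t \<in> M) \<and>
         (\<gamma> has_vector_derivative v) (at 0)}"

text \<open>
  The points of \<open>M\<close> where the differential of \<open>(g\<^sub>j)\<^bsub>j\<in>J\<^esub> : M \<rightarrow> \<bbbA>\<^sup>J\<close> is not surjective.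
  Tuples indexed by a subset \<open>J\<close> of the index type are extensional functions on \<open>J\<close>.
\<close>

definition Sing :: "'v::real_normed_vector set \<Rightarrow> 'k set \<Rightarrow> ('k \<Rightarrow> 'v \<Rightarrow> 'a::real_normed_vector) \<Rightarrow> 'v set"
  where
  "Sing M J g =
     {x \<in> M. (\<lambda>v. \<lambda>j\<in>J. frechet_derivative (g j) (at x) v) ` tangent_space M x \<noteq> (\<Pi>\<^sub>E j\<in>J. UNIV)}"

definition Disc :: "'v::real_normed_vector set \<Rightarrow> 'k set \<Rightarrow> ('k \<Rightarrow> 'v \<Rightarrow> 'a::real_normed_vector) \<Rightarrow> ('k \<Rightarrow> 'a) set"
  where
  "Disc M J g = (\<lambda>x. \<lambda>j\<in>J. g j x) ` Sing M J g"

lemma tangent_space_open: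
  assumes "open M" "x \<in> M"
  shows "tangent_space M x = UNIV"
proof -
  have "v \<in> tangent_space M x" for v
  proof -
    let ?\<gamma> = "\<lambda>t::real. x + t *\<^sub>R v"
    have der: "(?\<gamma> has_vector_derivative v) (at 0)"
      by (auto intro!: derivative_eq_intros)
    have "(?\<gamma> \<longlongrightarrow> x + 0 *\<^sub>R v) (nhds 0)"
      by (intro tendsto_intros filterlim_ident)
    then have "\<forall>\<^sub>F t in nhds 0. ?\<gamma> t \<in> M"
      using assms by (auto simp: tendsto_def)
    with der show ?thesis
      unfolding tangent_space_def by (auto intro!: exI[of _ ?\<gamma>])
  qed
  then show ?thesis by blast
qed

lemma Sing_open:
  fixes M :: "'a::real_normed_vector set" and g :: "'b \<Rightarrow> 'a \<Rightarrow> 'c::real_normed_vector"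
  assumes "open M"
  shows "Sing M J g =
    {x \<in> M. \<not> (\<forall>y. \<exists>v. \<forall>j\<in>J. frechet_derivative (g j) (at x) v = y j)}"
proof -
  have eq: "(range (\<lambda>v. \<lambda>j\<in>J. D j v) = (\<Pi>\<^sub>E j\<in>J. UNIV)) \<longleftrightarrow> (\<forall>y. \<exists>v. \<forall>j\<in>J. D j v = y j)"
    (is "?L \<longleftrightarrow> ?R") for D :: "'b \<Rightarrow> 'a \<Rightarrow> 'c"
  proof
    assume L: ?L
    show ?R
    proof
      fix y :: "'b \<Rightarrow> 'c"
      have "restrict y J \<in> range (\<lambda>v. \<lambda>j\<in>J. D j v)" unfolding L by auto
      then obtain v where "restrict y J = (\<lambda>j\<in>J. D j v)" by auto
      then have "\<forall>j\<in>J. D j v = y j" by (metis restrict_apply')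
      then show "\<exists>v. \<forall>j\<in>J. D j v = y j" ..
    qed
  next
    assume R: ?R
    have "y \<in> range (\<lambda>v. \<lambda>j\<in>J. D j v)" if y: "y \<in> (\<Pi>\<^sub>E j\<in>J. UNIV)" for y
    proof -
      obtain v where v: "\<forall>j\<in>J. D j v = y j" using R by blast
      have "y = (\<lambda>j\<in>J. D j v)"
        using v y by (auto simp: fun_eq_iff PiE_def extensional_def)
      then show ?thesis by blast
    qed
    then show ?L by auto
  qed
  show ?thesis
    unfolding Sing_def
    by (rule Collect_cong, rule conj_cong[OF refl])
      (simp only: tangent_space_open[OF assms] eq)
qed

definition locally_trivial_fibration_over ::
    "('x::topological_space \<Rightarrow> 'y::topological_space) \<Rightarrow> 'y set \<Rightarrow> bool" where
  "locally_trivial_fibration_over F S \<longleftrightarrow>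
     (\<forall>t\<in>S. \<exists>U h h'. openin (top_of_set S) U \<and> t \<in> U \<and>
        homeomorphism (F -` U) (U \<times> F -` {t}) h h' \<and> (\<forall>x\<in>F -` U. fst (h x) = F x))"

text \<open>
  Minimality is meant among closed sets: over a single point every map is a trivial fibration, so
  there is no minimal set if the complement is not required to be open.
\<close>

definition bifurcation_locus :: "('x::topological_space \<Rightarrow> 'y::topological_space) \<Rightarrow> 'y set" where
  "bifurcation_locus F = \<Inter>{B. closed B \<and> locally_trivial_fibration_over F (- B)}"

lemma bifurcation_locus_minimal:
  shows "closed (bifurcation_locus F)"
    and "locally_trivial_fibration_over F (- bifurcation_locus F)"
    and "closed B \<Longrightarrow> locally_trivial_fibration_over F (- B) \<Longrightarrow> bifurcation_locus F \<subseteq> B"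
proof -
  show cl: "closed (bifurcation_locus F)"
    unfolding bifurcation_locus_def by auto
  show "locally_trivial_fibration_over F (- bifurcation_locus F)"
    unfolding locally_trivial_fibration_over_def
  proof
    fix t assume "t \<in> - bifurcation_locus F"
    then obtain B where B: "closed B" "locally_trivial_fibration_over F (- B)" "t \<in> - B"
      unfolding bifurcation_locus_def by auto
    then obtain U h h' where U: "openin (top_of_set (- B)) U" "t \<in> U"
        "homeomorphism (F -` U) (U \<times> F -` {t}) h h'" "\<forall>x\<in>F -` U. fst (h x) = F x"
      using bspec[OF B(2)[unfolded locally_trivial_fibration_over_def] B(3)] by (elim exE conjE)
    have "open U" using U(1) B(1) openin_open_trans by blast
    moreover have "U \<subseteq> - bifurcation_locus F"
      using openin_imp_subset[OF U(1)] B(1,2) unfolding bifurcation_locus_def by blast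
    ultimately have "openin (top_of_set (- bifurcation_locus F)) U"
      by (simp add: open_subset)
    with U(2-4) show "\<exists>U h h'. openin (top_of_set (- bifurcation_locus F)) U \<and> t \<in> U \<and>
        homeomorphism (F -` U) (U \<times> F -` {t}) h h' \<and> (\<forall>x\<in>F -` U. fst (h x) = F x)"
      by (intro exI conjI)
  qed
  show "closed B \<Longrightarrow> locally_trivial_fibration_over F (- B) \<Longrightarrow> bifurcation_locus F \<subseteq> B"
    unfolding bifurcation_locus_def by auto
qed

definition real_point :: "nat ^ 'n::finite \<Rightarrow> real ^ 'n" where
  "real_point \<nu> = (\<chi> i. real (\<nu> $ i))"

definition supp :: "('m, 'n::finite, 'a) monomials \<Rightarrow> ('m \<Rightarrow>\<^sub>0 'a::zero) \<Rightarrow> (real ^ 'n) set" where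
  "supp K f = (\<lambda>m. real_point (exponent K m)) ` Poly_Mapping.keys f"

definition Gamma0 :: "('m, 'n::finite, 'a) monomials \<Rightarrow> ('m \<Rightarrow>\<^sub>0 'a::zero) \<Rightarrow> (real ^ 'n) set" where
  "Gamma0 K f = convex hull (insert 0 (supp K f))"

definition part_fun ::
    "('m, 'n::finite, 'a) monomials \<Rightarrow> ('m \<Rightarrow>\<^sub>0 'a::comm_semiring_1) \<Rightarrow> (real ^ 'n) set \<Rightarrow> 'a ^ 'n \<Rightarrow> 'a" where
  "part_fun K f \<Delta> x =
     (\<Sum>m | m \<in> Poly_Mapping.keys f \<and> real_point (exponent K m) \<in> \<Delta>.
        Poly_Mapping.lookup f m * monom_fun K m x)"

definition min_face ::
    "('m, 'n::finite, 'a) monomials \<Rightarrow> ('m \<Rightarrow>\<^sub>0 'a::zero) \<Rightarrow> real ^ 'n \<Rightarrow> (real ^ 'n) set" where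
  "min_face K f p = {v \<in> Gamma0 K f. \<forall>w\<in>Gamma0 K f. p \<bullet> v \<le> p \<bullet> w}"

text \<open>
  Convex polyhedral cones that are only locally closed: some of the finitely many homogeneous
  linear inequalities may be strict, as is needed to partition \<open>\<real>\<^sup>n - \<real>\<^sub>+\<^sup>n\<close>.
\<close>

definition polyhedral_cone :: "'v::euclidean_space set \<Rightarrow> bool" where
  "polyhedral_cone \<sigma> \<longleftrightarrow>
     (\<exists>A B. finite A \<and> finite B \<and> \<sigma> = {p. (\<forall>a\<in>A. 0 \<le> a \<bullet> p) \<and> (\<forall>b\<in>B. 0 < b \<bullet> p)})"

definition dual_equiv ::
    "('m, 'n::finite, 'a) monomials \<Rightarrow> ('k \<Rightarrow> 'm \<Rightarrow>\<^sub>0 'a::zero) \<Rightarrow> real ^ 'n \<Rightarrow> real ^ 'n \<Rightarrow> bool" where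
  "dual_equiv K F p q \<longleftrightarrow> (\<forall>j. min_face K (F j) p = min_face K (F j) q)"

text \<open>
  The subdivision of the equivalence classes into convex cones is not canonical, so being such a
  family of cones is a property of \<open>\<C>\<close>.
\<close>

definition dual_subdivision ::
    "('m, 'n::finite, 'a) monomials \<Rightarrow> ('k \<Rightarrow> 'm \<Rightarrow>\<^sub>0 'a::zero) \<Rightarrow> (real ^ 'n) set set \<Rightarrow> bool" where
  "dual_subdivision K F \<C> \<longleftrightarrow>
     finite \<C> \<and> partition_on {p. \<exists>i. p $ i < 0} \<C> \<and>
     (\<forall>\<sigma>\<in>\<C>. polyhedral_cone \<sigma> \<and> (\<forall>p\<in>\<sigma>. \<forall>q\<in>\<sigma>. dual_equiv K F p q))"

definition cone_face ::
    "('m, 'n::finite, 'a) monomials \<Rightarrow> ('k \<Rightarrow> 'm \<Rightarrow>\<^sub>0 'a::zero) \<Rightarrow> (real ^ 'n) set \<Rightarrow> 'k \<Rightarrow> (real ^ 'n) set" where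
  "cone_face K F \<sigma> j = min_face K (F j) (SOME p. p \<in> \<sigma>)"

lemma cone_face_eq:
  assumes "dual_subdivision K F \<C>" "\<sigma> \<in> \<C>" "p \<in> \<sigma>"
  shows "cone_face K F \<sigma> j = min_face K (F j) p"
proof -
  have "(SOME p. p \<in> \<sigma>) \<in> \<sigma>" using assms(3) by (rule someI)
  then show ?thesis
    using assms(1)[unfolded dual_subdivision_def] assms(2,3)
    unfolding dual_equiv_def cone_face_def by metis
qed

context
  fixes K :: "('m, 'n::finite, 'a::zero) monomials"
begin

lemma Gamma0_le_iff:
  "(\<forall>w\<in>Gamma0 K f. p \<bullet> v \<le> p \<bullet> w) \<longleftrightarrow> (\<forall>w\<in>insert 0 (supp K f). p \<bullet> v \<le> p \<bullet> w)"
  (is "?L \<longleftrightarrow> ?R")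
proof
  assume ?L then show ?R unfolding Gamma0_def by (blast intro: hull_inc)
next
  assume ?R
  then have "insert 0 (supp K f) \<subseteq> {w. p \<bullet> w \<ge> p \<bullet> v}" by auto
  then have "Gamma0 K f \<subseteq> {w. p \<bullet> w \<ge> p \<bullet> v}"
    unfolding Gamma0_def by (intro hull_minimal convex_halfspace_ge)
  then show ?L by auto
qed

lemma min_face_face_of: "min_face K f p face_of Gamma0 K f"
proof (cases "min_face K f p = {}")
  case False
  then obtain v where v: "v \<in> Gamma0 K f" "\<forall>w\<in>Gamma0 K f. p \<bullet> v \<le> p \<bullet> w"
    unfolding min_face_def by blast
  have "min_face K f p = Gamma0 K f \<inter> {w. p \<bullet> w = p \<bullet> v}"
    using v unfolding min_face_def by (auto intro: antisym)
  moreover have "Gamma0 K f \<inter> {w. p \<bullet> w = p \<bullet> v} face_of Gamma0 K f"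
    using v by (intro face_of_Int_supporting_hyperplane_ge) (auto simp: Gamma0_def)
  ultimately show ?thesis by simp
qed simp

lemma min_face_eq_hull:
  "min_face K f p = convex hull (insert 0 (supp K f) \<inter> min_face K f p)"
proof -
  have "finite (insert 0 (supp K f))" by (simp add: supp_def)
  then obtain S where S: "S \<subseteq> insert 0 (supp K f)" "min_face K f p = convex hull S"
    using face_of_convex_hull_subset[of "insert 0 (supp K f)" "min_face K f p"]
      min_face_face_of[of f p] by (metis Gamma0_def finite_imp_compact)
  have "S \<subseteq> insert 0 (supp K f) \<inter> min_face K f p"
    using S by (metis Int_subset_iff hull_subset)
  then have "min_face K f p \<subseteq> convex hull (insert 0 (supp K f) \<inter> min_face K f p)"
    using S(2) hull_mono by metis
  moreover have "convex hull (insert 0 (supp K f) \<inter> min_face K f p) \<subseteq> min_face K f p"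
    using face_of_imp_convex[OF min_face_face_of] by (intro hull_minimal) auto
  ultimately show ?thesis by blast
qed

lemma dual_subdivision_exists:
  fixes F :: "'k::finite \<Rightarrow> 'm \<Rightarrow>\<^sub>0 'a"
  shows "\<exists>\<C>. dual_subdivision K F \<C>"
proof -
  obtain e :: "'n \<Rightarrow> nat" where e: "inj e"
    using finite_imp_inj_to_nat_seg[of "UNIV :: 'n set"] by auto
  define S where "S = (\<lambda>j. insert 0 (supp K (F j)))"
  define M where "M = (\<lambda>p j. S j \<inter> min_face K (F j) p)"
  have M: "M p j = {v \<in> S j. \<forall>w\<in>S j. p \<bullet> v \<le> p \<bullet> w}" for p j
    unfolding M_def min_face_def using Gamma0_le_iff[where f = "F j"]
    by (auto simp: S_def Gamma0_def hull_inc)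
  have finS: "finite (S j)" for j by (simp add: S_def supp_def)
  have Mne: "M p j \<noteq> {}" for p j
  proof -
    have "S j \<noteq> {}" by (simp add: S_def)
    then obtain v where "v \<in> S j" "\<forall>w\<in>S j. p \<bullet> v \<le> p \<bullet> w"
      using finS[of j] by (metis arg_min_if_finite(1) arg_min_least)
    then show ?thesis unfolding M by blast
  qed
  define first where "first = (\<lambda>(p :: real ^ 'n) i. p $ i < 0 \<and> (\<forall>l. e l < e i \<longrightarrow> 0 \<le> p $ l))"
  have first_ex: "\<exists>i. first p i" if neg: "\<exists>i. p $ i < 0" for p
  proof -
    obtain i0 where "p $ i0 < 0" using neg by blast
    then obtain i where "p $ i < 0" "\<forall>l. p $ l < 0 \<longrightarrow> e i \<le> e l"
      using ex_has_least_nat[of "\<lambda>i. p $ i < 0" i0 e] by auto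
    then show ?thesis unfolding first_def by (meson linorder_not_le)
  qed
  have first_uniq: "i = l" if "first p i" "first p l" for p i l
    using that e unfolding first_def by (metis injD leD nat_neq_iff)
  define cell where "cell = (\<lambda>(m, i). {p. first p i \<and> M p = m})"
  define \<C> where "\<C> = cell ` (Pi\<^sub>E UNIV (\<lambda>j. Pow (S j)) \<times> UNIV) - {{}}"
  have "finite (Pi\<^sub>E UNIV (\<lambda>j. Pow (S j)) \<times> (UNIV :: 'n set))"
    using finS by (intro finite_cartesian_product finite_PiE) auto
  then have "finite \<C>" unfolding \<C>_def by blast
  moreover have "partition_on {p. \<exists>i. p $ i < 0} \<C>"
  proof (rule partition_onI)
    show "\<Union>\<C> = {p. \<exists>i. p $ i < 0}"
    proof (intro equalityI subsetI)
      fix p :: "real ^ 'n" assume "p \<in> {p. \<exists>i. p $ i < 0}"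
      then obtain i where "first p i" using first_ex by blast
      then have "p \<in> cell (M p, i)" by (simp add: cell_def)
      moreover have "M p \<in> Pi\<^sub>E UNIV (\<lambda>j. Pow (S j))" by (auto simp: M_def)
      ultimately show "p \<in> \<Union>\<C>" unfolding \<C>_def by blast
    qed (auto simp: \<C>_def cell_def first_def)
    show "disjnt \<sigma> \<tau>" if "\<sigma> \<in> \<C>" "\<tau> \<in> \<C>" "\<sigma> \<noteq> \<tau>" for \<sigma> \<tau>
    proof -
      obtain m i m' i' where eqs: "\<sigma> = cell (m, i)" "\<tau> = cell (m', i')"
        using \<open>\<sigma> \<in> \<C>\<close> \<open>\<tau> \<in> \<C>\<close> unfolding \<C>_def by blast
      have "m = m' \<and> i = i'" if "p \<in> \<sigma>" "p \<in> \<tau>" for p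
        using that first_uniq unfolding eqs cell_def by auto
      with \<open>\<sigma> \<noteq> \<tau>\<close> show ?thesis unfolding eqs disjnt_def by blast
    qed
  qed (auto simp: \<C>_def)
  moreover have "dual_equiv K F p q" if "\<sigma> \<in> \<C>" "p \<in> \<sigma>" "q \<in> \<sigma>" for \<sigma> p q
  proof -
    have "M p = M q" using that unfolding \<C>_def cell_def by auto
    then show ?thesis
      unfolding dual_equiv_def using min_face_eq_hull unfolding M_def S_def by metis
  qed
  moreover have "polyhedral_cone \<sigma>" if sig: "\<sigma> \<in> \<C>" for \<sigma>
  proof -
    obtain m i p0 where \<sigma>: "\<sigma> = cell (m, i)" and p0: "M p0 = m"
      using sig unfolding \<C>_def cell_def by blast
    define A where "A = (\<lambda>l. axis l (1::real)) ` {l. e l < e i} \<union>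
        (\<Union>j. (\<lambda>(u, w). w - u) ` (m j \<times> S j))"
    define B where "B = insert (- axis i (1::real))
        (\<Union>j. (\<lambda>(u, w). w - u) ` (m j \<times> (S j - m j)))"
    have fm: "finite (m j)" "m j \<subseteq> S j" "m j \<noteq> {}" for j
      using p0 Mne[of p0 j] finS[of j] finite_subset unfolding M by auto
    have "finite A" "finite B"
      unfolding A_def B_def using fm finS by auto
    moreover have "\<sigma> = {p. (\<forall>a\<in>A. 0 \<le> a \<bullet> p) \<and> (\<forall>b\<in>B. 0 < b \<bullet> p)}"
    proof -
      have "M p = m \<longleftrightarrow> (\<forall>j. (\<forall>u\<in>m j. \<forall>w\<in>S j. p \<bullet> u \<le> p \<bullet> w) \<and>
          (\<forall>u\<in>m j. \<forall>w\<in>S j - m j. p \<bullet> u < p \<bullet> w))" (is "?L \<longleftrightarrow> ?R") for p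
      proof
        assume L: ?L
        show ?R unfolding L[symmetric] M by (force simp: not_le)
      next
        assume R: ?R
        show ?L
        proof
          fix j
          obtain u where u: "u \<in> m j" "u \<in> S j" using fm[of j] by blast
          have "v \<in> m j" if "v \<in> M p j" for v
            using that u R unfolding M by (metis (no_types, lifting) DiffI mem_Collect_eq not_le)
          moreover have "v \<in> M p j" if "v \<in> m j" for v
            using that fm[of j] R unfolding M by blast
          ultimately show "M p j = m j" by blast
        qed
      qed
      moreover have "(\<forall>a\<in>A. 0 \<le> a \<bullet> p) \<longleftrightarrow> (\<forall>l. e l < e i \<longrightarrow> 0 \<le> p $ l) \<and>
          (\<forall>j. \<forall>u\<in>m j. \<forall>w\<in>S j. p \<bullet> u \<le> p \<bullet> w)" for p
        unfolding A_def ball_Un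
        by (simp add: inner_axis inner_diff_right inner_commute[of _ p] split_beta)
      moreover have "(\<forall>b\<in>B. 0 < b \<bullet> p) \<longleftrightarrow> p $ i < 0 \<and>
          (\<forall>j. \<forall>u\<in>m j. \<forall>w\<in>S j - m j. p \<bullet> u < p \<bullet> w)" for p
        unfolding B_def
        by (simp add: inner_axis inner_diff_right inner_commute[of _ p] split_beta)
      ultimately show ?thesis
        unfolding \<sigma> cell_def first_def by auto
    qed
    ultimately show ?thesis unfolding polyhedral_cone_def by blast
  qed
  ultimately show ?thesis unfolding dual_subdivision_def by blast
qed

end

context
  fixes K :: "('m, 'n::finite, 'a::real_normed_field) monomials"
    and F :: "'k::finite \<Rightarrow> 'm \<Rightarrow>\<^sub>0 'a"
begin

definition I_cone :: "(real ^ 'n) set \<Rightarrow> 'k set" where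
  "I_cone \<sigma> = {j. 0 \<notin> cone_face K F \<sigma> j}"

definition J_cone :: "(real ^ 'n) set \<Rightarrow> 'k set" where
  "J_cone \<sigma> = {j. cone_face K F \<sigma> j = {0}}"

definition cone_part :: "(real ^ 'n) set \<Rightarrow> 'k \<Rightarrow> 'a ^ 'n \<Rightarrow> 'a" where
  "cone_part \<sigma> j = part_fun K (F j) (cone_face K F \<sigma> j)"

definition G_cone :: "(real ^ 'n) set \<Rightarrow> ('a ^ 'n) set" where
  "G_cone \<sigma> = {x. (\<forall>i. x $ i \<noteq> 0) \<and> (\<forall>j\<in>I_cone \<sigma>. cone_part \<sigma> j x = 0)}"

definition nondegenerate_at_infinity :: "(real ^ 'n) set set \<Rightarrow> bool" where
  "nondegenerate_at_infinity \<C> \<longleftrightarrow>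
     (\<forall>\<sigma>\<in>\<C>. I_cone \<sigma> \<noteq> {} \<and> J_cone \<sigma> = {} \<longrightarrow>
        Sing UNIV (I_cone \<sigma>) (cone_part \<sigma>) \<inter> G_cone \<sigma> = {})"

definition N_set :: "(real ^ 'n) set set \<Rightarrow> ('a ^ 'k) set" where
  "N_set \<C> = (\<Union>\<sigma>\<in>{\<sigma> \<in> \<C>. J_cone \<sigma> \<noteq> {}}. {z. \<forall>j\<in>J_cone \<sigma>. z $ j = 0})"

definition A_set :: "(real ^ 'n) set set \<Rightarrow> ('a ^ 'k) set" where
  "A_set \<C> = (\<Union>\<sigma>\<in>{\<sigma> \<in> \<C>. J_cone \<sigma> = {} \<and> - I_cone \<sigma> \<noteq> {}}.
     {z. (\<lambda>j\<in>- I_cone \<sigma>. z $ j) \<in> Disc (G_cone \<sigma>) (- I_cone \<sigma>) (cone_part \<sigma>)})"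

end

end

theory Submission
  imports Defs
begin

text \<open>
  Let \<open>t\<close> lie outside the three sets. The heart of the matter is the Malgrange condition at \<open>t\<close>:
  \<open>(1 + \<bar>x\<bar>) \<bar>dF(x)\<^sup>* w\<bar> \<ge> \<epsilon> \<bar>w\<bar>\<close> whenever \<open>\<bar>F x - t\<bar> < \<epsilon>\<close>. If it fails, there is a sequence of points
  \<open>x\<^sub>n\<close>, with nonzero coordinates, violating it more and more, with \<open>F x\<^sub>n\<close> tending to \<open>t\<close>. If the sequence has a
  bounded subsequence, \<open>t\<close> is a critical value. Otherwise, separating a cone of exponents from a subspace by a
  hyperplane yields a direction \<open>p\<close>, with a negative coordinate, that orders the monomials occurring in \<open>F\<close>
  by their growth along a subsequence. Dividing each coordinate by its growth, the rescaled points
  converge to some \<open>a\<close> with nonzero coordinates, the rescaled components and their differentials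
  converge to the face parts at \<open>a\<close>, and the violation becomes a nontrivial linear relation
  between the differentials of the face parts at \<open>a\<close>. Non-degeneracy then puts \<open>t\<close> into one of the
  other two sets.

  Under the Malgrange condition, straight segments near \<open>t\<close> lift by the flow of a locally Lipschitz
  field of linear growth, which is therefore complete; this trivialises \<open>F\<close> over a ball around \<open>t\<close>.
\<close>

subsection \<open>Maps that are Lipschitz on balls\<close>

text \<open>Local Lipschitz continuity with one constant per ball about the origin. Such maps are
  bounded on balls without any appeal to compactness, which closes the class under products and
  composition; it is the regularity required of a vector field.\<close>

definition lipschitz_on_balls :: "('a::real_normed_vector \<Rightarrow> 'b::real_normed_vector) \<Rightarrow> bool" where
  "lipschitz_on_balls f \<longleftrightarrow> (\<forall>r. \<exists>L. L-lipschitz_on (cball 0 r) f)"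

lemma lipschitz_on_ballsI:
  assumes "\<And>r. 0 \<le> r \<Longrightarrow> \<exists>L. \<forall>x y. norm x \<le> r \<longrightarrow> norm y \<le> r \<longrightarrow> norm (f x - f y) \<le> L * norm (x - y)"
  shows "lipschitz_on_balls f"
  unfolding lipschitz_on_balls_def
proof
  fix r :: real
  obtain L where L: "norm (f x - f y) \<le> L * norm (x - y)"
    if "norm x \<le> \<bar>r\<bar>" "norm y \<le> \<bar>r\<bar>" for x y
    using assms[of "\<bar>r\<bar>"] by auto
  \<comment> \<open>\<open>lipschitz_on\<close> includes nonnegativity of the constant, hence
    \<open>\<bar>L\<bar>\<close>.\<close>
  have "norm (f x - f y) \<le> \<bar>L\<bar> * norm (x - y)" if "norm x \<le> r" "norm y \<le> r" for x y
    using L[of x y] that mult_right_mono[OF abs_ge_self, of "norm (x - y)" L] by fastforce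
  then have "\<bar>L\<bar>-lipschitz_on (cball 0 r) f"
    by (intro lipschitz_onI) (auto simp: dist_norm)
  then show "\<exists>L. L-lipschitz_on (cball 0 r) f" by blast
qed

lemma lipschitz_on_ballsE:
  assumes "lipschitz_on_balls f"
  obtains L where "0 \<le> L"
    "\<And>x y. norm x \<le> r \<Longrightarrow> norm y \<le> r \<Longrightarrow> norm (f x - f y) \<le> L * norm (x - y)"
proof -
  obtain L where L: "L-lipschitz_on (cball 0 r) f"
    using assms unfolding lipschitz_on_balls_def by blast
  then show ?thesis
    using that[of L] lipschitz_on_nonneg[OF L] lipschitz_on_normD[OF L] by simp
qed

lemma lipschitz_on_balls_continuous:
  assumes "lipschitz_on_balls f"
  shows "continuous_on UNIV f"
proof -
  have "isCont f x" for x
  proof -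
    obtain L where "L-lipschitz_on (cball 0 (norm x + 1)) f"
      using assms unfolding lipschitz_on_balls_def by blast
    then have "continuous_on (ball x 1) f"
      by (rule continuous_on_subset[OF lipschitz_on_continuous_on])
        (auto simp: dist_norm, metis add.commute add_left_mono less_eq_real_def norm_minus_commute
          norm_triangle_sub order_trans)
    then show ?thesis by (simp add: continuous_on_eq_continuous_at)
  qed
  then show ?thesis by (simp add: continuous_at_imp_continuous_on)
qed

lemma lipschitz_on_balls_bounded:
  assumes "lipschitz_on_balls f"
  obtains B where "0 \<le> B" "\<And>x. norm x \<le> r \<Longrightarrow> norm (f x) \<le> B"
proof -
  obtain L where L: "0 \<le> L"
    "\<And>x y. norm x \<le> \<bar>r\<bar> \<Longrightarrow> norm y \<le> \<bar>r\<bar> \<Longrightarrow> norm (f x - f y) \<le> L * norm (x - y)"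
    using lipschitz_on_ballsE[OF assms] by blast
  have "norm (f x) \<le> norm (f 0) + L * \<bar>r\<bar>" if "norm x \<le> r" for x
  proof -
    have "norm (f x) \<le> norm (f 0) + norm (f x - f 0)"
      by (metis add.commute diff_add_cancel norm_triangle_ineq)
    also have "norm (f x - f 0) \<le> L * norm x" using L(2)[of x 0] that by auto
    also have "\<dots> \<le> L * \<bar>r\<bar>" using L(1) that by (intro mult_left_mono) auto
    finally show ?thesis by simp
  qed
  then show ?thesis using that[of "norm (f 0) + L * \<bar>r\<bar>"] L(1) by simp
qed

lemma lipschitz_on_balls_const: "lipschitz_on_balls (\<lambda>x. c)"
  unfolding lipschitz_on_balls_def by (blast intro: lipschitz_intros)

lemma lipschitz_on_balls_linear:
  assumes "bounded_linear f"
  shows "lipschitz_on_balls f"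
  unfolding lipschitz_on_balls_def
  using bounded_linear.lipschitz_boundE[OF assms] by blast

lemma lipschitz_on_balls_add:
  assumes "lipschitz_on_balls f" "lipschitz_on_balls g"
  shows "lipschitz_on_balls (\<lambda>x. f x + g x)"
  using assms unfolding lipschitz_on_balls_def by (blast intro: lipschitz_on_add)

lemma lipschitz_on_balls_diff:
  assumes "lipschitz_on_balls f" "lipschitz_on_balls g"
  shows "lipschitz_on_balls (\<lambda>x. f x - g x)"
  using assms unfolding lipschitz_on_balls_def by (blast intro: lipschitz_on_diff)

lemma lipschitz_on_balls_sum:
  assumes "\<And>i. i \<in> I \<Longrightarrow> lipschitz_on_balls (f i)"
  shows "lipschitz_on_balls (\<lambda>x. \<Sum>i\<in>I. f i x)"
  using assms
  by (induction I rule: infinite_finite_induct)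
    (auto intro: lipschitz_on_balls_const lipschitz_on_balls_add)

text \<open>The increment of a product splits into two terms, each with one factor bounded on the
  ball and one increment.\<close>

lemma lipschitz_on_balls_bilinear:
  assumes h: "bounded_bilinear h" and f: "lipschitz_on_balls f" and g: "lipschitz_on_balls g"
  shows "lipschitz_on_balls (\<lambda>x. h (f x) (g x))"
proof (rule lipschitz_on_ballsI)
  fix r :: real
  obtain K where K: "0 \<le> K" "\<And>a b. norm (h a b) \<le> norm a * norm b * K"
    using bounded_bilinear.nonneg_bounded[OF h] by blast
  obtain Lf where Lf: "0 \<le> Lf"
    "\<And>x y. norm x \<le> r \<Longrightarrow> norm y \<le> r \<Longrightarrow> norm (f x - f y) \<le> Lf * norm (x - y)"
    using lipschitz_on_ballsE[OF f] by blast
  obtain Lg where Lg: "0 \<le> Lg"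
    "\<And>x y. norm x \<le> r \<Longrightarrow> norm y \<le> r \<Longrightarrow> norm (g x - g y) \<le> Lg * norm (x - y)"
    using lipschitz_on_ballsE[OF g] by blast
  obtain Bf where Bf: "0 \<le> Bf" "\<And>x. norm x \<le> r \<Longrightarrow> norm (f x) \<le> Bf"
    using lipschitz_on_balls_bounded[OF f] by blast
  obtain Bg where Bg: "0 \<le> Bg" "\<And>x. norm x \<le> r \<Longrightarrow> norm (g x) \<le> Bg"
    using lipschitz_on_balls_bounded[OF g] by blast
  have "norm (h (f x) (g x) - h (f y) (g y)) \<le> (Bf * Lg * K + Lf * Bg * K) * norm (x - y)"
    if x: "norm x \<le> r" and y: "norm y \<le> r" for x y
  proof -
    have "h (f x) (g x) - h (f y) (g y) = h (f x) (g x - g y) + h (f x - f y) (g y)"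
      by (simp add: bounded_bilinear.diff_left[OF h] bounded_bilinear.diff_right[OF h])
    then have "norm (h (f x) (g x) - h (f y) (g y))
        \<le> norm (f x) * norm (g x - g y) * K + norm (f x - f y) * norm (g y) * K"
      using K(2) by (smt (verit, best) norm_triangle_ineq)
    also have "\<dots> \<le> Bf * (Lg * norm (x - y)) * K + Lf * norm (x - y) * Bg * K"
      using Bf Bg Lf Lg K x y by (intro add_mono mult_mono mult_right_mono) auto
    finally show ?thesis by (simp add: algebra_simps)
  qed
  then show "\<exists>L. \<forall>x y. norm x \<le> r \<longrightarrow> norm y \<le> r \<longrightarrow>
      norm (h (f x) (g x) - h (f y) (g y)) \<le> L * norm (x - y)" by blast
qed

lemma lipschitz_on_balls_compose:
  assumes f: "lipschitz_on_balls f" and g: "lipschitz_on_balls g"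
  shows "lipschitz_on_balls (\<lambda>x. f (g x))"
  unfolding lipschitz_on_balls_def
proof
  fix r :: real
  obtain B where B: "\<And>x. norm x \<le> r \<Longrightarrow> norm (g x) \<le> B"
    using lipschitz_on_balls_bounded[OF g] by blast
  obtain L M where "L-lipschitz_on (cball 0 r) g" "M-lipschitz_on (cball 0 B) f"
    using f g unfolding lipschitz_on_balls_def by meson
  moreover have "g ` cball 0 r \<subseteq> cball 0 B" using B by auto
  ultimately have "(M * L)-lipschitz_on (cball 0 r) (\<lambda>x. f (g x))"
    by (intro lipschitz_on_compose2) (auto intro: lipschitz_on_subset)
  then show "\<exists>L. L-lipschitz_on (cball 0 r) (\<lambda>x. f (g x))" by blast
qed

lemma lipschitz_on_balls_global:
  assumes "L-lipschitz_on UNIV f"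
  shows "lipschitz_on_balls f"
  unfolding lipschitz_on_balls_def using lipschitz_on_subset[OF assms] by blast

lemma lipschitz_on_balls_Pair:
  assumes "lipschitz_on_balls f" "lipschitz_on_balls g"
  shows "lipschitz_on_balls (\<lambda>x. (f x, g x))"
  using assms unfolding lipschitz_on_balls_def by (blast intro: lipschitz_on_Pair)

lemmas lipschitz_on_balls_fst = lipschitz_on_balls_linear[OF bounded_linear_fst]
lemmas lipschitz_on_balls_snd = lipschitz_on_balls_linear[OF bounded_linear_snd]

lemma lipschitz_on_balls_max_norm:
  assumes "lipschitz_on_balls f"
  shows "lipschitz_on_balls (\<lambda>x. max (0::real) (norm (f x) - d))"
proof -
  have "1-lipschitz_on UNIV (\<lambda>y :: 'b. max (0::real) (norm y - d))"
  proof (rule lipschitz_onI)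
    fix y z :: 'b
    have "\<bar>norm y - norm z\<bar> \<le> norm (y - z)" by (rule norm_triangle_ineq3)
    then show "dist (max 0 (norm y - d)) (max 0 (norm z - d)) \<le> 1 * dist y z"
      by (auto simp: dist_norm max_def)
  qed simp
  from lipschitz_on_balls_compose[OF lipschitz_on_balls_global[OF this] assms] show ?thesis .
qed

text \<open>Expanding \<open>w\<close> in a basis turns \<open>Q x w\<close> into a finite sum of
  products of a coordinate of \<open>w\<close> with a function of \<open>x\<close> alone. So
  regularity in \<open>x\<close> for fixed \<open>w\<close> gives joint regularity.\<close>

lemma lipschitz_on_balls_joint:
  fixes Q :: "'v::real_normed_vector \<Rightarrow> 'w::euclidean_space \<Rightarrow> 'u::real_normed_vector"
  assumes lin: "\<And>x. linear (Q x)" and lip: "\<And>w. lipschitz_on_balls (\<lambda>x. Q x w)"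
  shows "lipschitz_on_balls (\<lambda>p. Q (fst p) (snd p))"
proof -
  have eq: "Q x w = (\<Sum>b\<in>Basis. (w \<bullet> b) *\<^sub>R Q x b)" for x w
    by (subst euclidean_representation[symmetric, of w])
      (simp add: linear_sum[OF lin] linear_cmul[OF lin])
  show ?thesis
    unfolding ext[of "\<lambda>p. Q (fst p) (snd p)", OF eq]
  proof (rule lipschitz_on_balls_sum)
    fix b :: 'w
    have "bounded_linear (\<lambda>p :: 'v \<times> 'w. snd p \<bullet> b)"
      using bounded_linear_compose[OF bounded_linear_inner_left[of b] bounded_linear_snd] by simp
    then show "lipschitz_on_balls (\<lambda>p :: 'v \<times> 'w. (snd p \<bullet> b) *\<^sub>R Q (fst p) b)"
      by (rule lipschitz_on_balls_bilinear[OF bounded_bilinear_scaleR lipschitz_on_balls_linear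
            lipschitz_on_balls_compose[OF lip lipschitz_on_balls_fst]])
  qed
qed

text \<open>Projection to a ball serves as a Lipschitz truncation: of the state when solutions are
  constructed, and of the displacement in the lifting field.\<close>

lemma norm_closest_point_cball:
  fixes y :: "'e::euclidean_space"
  assumes "0 \<le> r"
  shows "norm (closest_point (cball 0 r) y) \<le> norm y" "norm (closest_point (cball 0 r) y) \<le> r"
    and "norm y \<le> r \<Longrightarrow> closest_point (cball 0 r) y = y"
proof -
  have ne: "cball (0::'e) r \<noteq> {}" using assms by simp
  show "norm (closest_point (cball 0 r) y) \<le> r"
    using closest_point_in_set[OF closed_cball ne, of y] by simp
  have "closest_point (cball 0 r) (0::'e) = 0" using assms by (intro closest_point_self) simp
  then show "norm (closest_point (cball 0 r) y) \<le> norm y"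
    using closest_point_lipschitz[OF convex_cball closed_cball ne, of y 0] by simp
  show "norm y \<le> r \<Longrightarrow> closest_point (cball 0 r) y = y" by (intro closest_point_self) simp
qed

lemma lipschitz_closest_point_cball:
  assumes "0 \<le> r"
  shows "1-lipschitz_on UNIV (closest_point (cball (0::'e::euclidean_space) r))"
  using closest_point_lipschitz[OF convex_cball closed_cball, of "0::'e" r] assms
  by (intro lipschitz_onI) auto

subsection \<open>Ordinary differential equations\<close>

text \<open>The weighted function \<open>exp (- K * s) * \<phi> s\<close> has nonpositive
  derivative.\<close>

lemma gronwall_real:
  fixes \<phi> \<phi>' :: "real \<Rightarrow> real"
  assumes der: "\<And>s. s \<in> {0..1} \<Longrightarrow> (\<phi> has_real_derivative \<phi>' s) (at s within {0..1})"
    and le: "\<And>s. s \<in> {0..1} \<Longrightarrow> \<phi>' s \<le> K * \<phi> s"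
    and s: "s \<in> {0..1}"
  shows "\<phi> s \<le> exp (K * s) * \<phi> 0"
proof -
  define \<psi> where "\<psi> = (\<lambda>s. exp (- K * s) * \<phi> s)"
  have d: "(\<psi> has_real_derivative exp (- K * s) * (\<phi>' s - K * \<phi> s)) (at s within {0..1})"
    if s: "s \<in> {0..1}" for s :: real
  proof -
    have "((\<lambda>s. exp (- K * s)) has_real_derivative exp (- K * s) * - K) (at s within {0..1})"
      by (auto intro!: derivative_eq_intros)
    from DERIV_mult[OF this der[OF s]] show ?thesis
      unfolding \<psi>_def by (simp add: algebra_simps)
  qed
  have "\<psi> s \<le> \<psi> 0"
  proof (rule DERIV_nonpos_imp_decreasing_open[where f = \<psi> and a = 0 and b = s])
    show "continuous_on {0..s} \<psi>"
      using d s by (intro continuous_on_subset[OF DERIV_continuous_on[of "{0..1}"]]) auto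
    show "\<exists>y. (\<psi> has_real_derivative y) (at x) \<and> y \<le> 0" if "0 < x" "x < s" for x
    proof -
      have "exp (- K * x) * (\<phi>' x - K * \<phi> x) \<le> 0"
        using le[of x] that s by (intro mult_nonneg_nonpos) auto
      then show ?thesis using d[of x] that s at_within_Icc_at[of 0 x 1] by auto
    qed
  qed (use s in auto)
  then have "exp (K * s) * \<psi> s \<le> exp (K * s) * \<psi> 0" by simp
  then show ?thesis unfolding \<psi>_def by (simp add: mult.assoc[symmetric] exp_add[symmetric])
qed

text \<open>The norm need not be differentiable where \<open>e\<close> vanishes, so the scalar
  inequality is applied to its square, with constant \<open>2 * L\<close>.\<close>

lemma gronwall_norm:
  fixes e e' :: "real \<Rightarrow> 'e::real_inner"
  assumes der: "\<And>s. s \<in> {0..1} \<Longrightarrow> (e has_vector_derivative e' s) (at s within {0..1})"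
    and le: "\<And>s. s \<in> {0..1} \<Longrightarrow> norm (e' s) \<le> L * norm (e s)"
    and s: "s \<in> {0..1}"
  shows "norm (e s) \<le> exp (L * s) * norm (e 0)"
proof -
  have "e s \<bullet> e s \<le> exp (2 * L * s) * (e 0 \<bullet> e 0)"
  proof (rule gronwall_real[where \<phi> = "\<lambda>s. e s \<bullet> e s" and \<phi>' = "\<lambda>s. 2 * (e s \<bullet> e' s)"])
    fix s :: real assume s: "s \<in> {0..1}"
    show "((\<lambda>s. e s \<bullet> e s) has_real_derivative 2 * (e s \<bullet> e' s)) (at s within {0..1})"
      using der[OF s] unfolding has_real_derivative_iff_has_vector_derivative has_vector_derivative_def
      by (auto intro!: derivative_eq_intros simp: fun_eq_iff inner_commute)
    have "e s \<bullet> e' s \<le> norm (e s) * norm (e' s)" by (rule norm_cauchy_schwarz)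
    also have "\<dots> \<le> norm (e s) * (L * norm (e s))" using le[OF s] by (intro mult_left_mono) auto
    finally show "2 * (e s \<bullet> e' s) \<le> 2 * L * (e s \<bullet> e s)"
      by (simp add: power2_norm_eq_inner[symmetric] power2_eq_square mult_ac)
  qed (use s in auto)
  then have "(norm (e s))\<^sup>2 \<le> (exp (L * s) * norm (e 0))\<^sup>2"
    by (simp add: power2_norm_eq_inner power_mult_distrib exp_double[symmetric] mult.assoc)
  then show ?thesis by (rule power2_le_imp_le) simp
qed

text \<open>Unit time suffices because the displacement to be lifted is carried in the state. At the
  ends of the interval the derivatives are one-sided.\<close>

definition solves :: "('e::real_normed_vector \<Rightarrow> 'e) \<Rightarrow> (real \<Rightarrow> 'e) \<Rightarrow> bool" where
  "solves G \<gamma> \<longleftrightarrow> (\<forall>s\<in>{0..1}. (\<gamma> has_vector_derivative G (\<gamma> s)) (at s within {0..1}))"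

text \<open>The weight \<open>exp (K s)\<close> with \<open>K > 2 L\<close> makes the Picard operator a contraction on the whole
  unit interval, whatever the size of \<open>L\<close>.\<close>

lemma picard:
  fixes H :: "'e::euclidean_space \<Rightarrow> 'e"
  assumes H: "L-lipschitz_on UNIV H"
  shows "\<exists>\<gamma>. \<gamma> 0 = x \<and> solves H \<gamma>"
proof -
  define K where "K = 2 * L + 1"
  have L: "0 \<le> L" using lipschitz_on_nonneg[OF H] .
  have K: "0 < K" "2 * L \<le> K" using L by (auto simp: K_def)
  have Hd: "norm (H a - H b) \<le> L * norm (a - b)" for a b
    using lipschitz_on_normD[OF H] by simp
  have Hc: "continuous_on UNIV H" using lipschitz_on_continuous_on[OF H] .
  define X :: "nat \<Rightarrow> real \<Rightarrow> 'e" where "X = rec_nat (\<lambda>_. x) (\<lambda>_ g s. x + integral {0..s} (\<lambda>\<tau>. H (g \<tau>)))"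
  have X0: "X 0 = (\<lambda>_. x)" and XS: "X (Suc n) = (\<lambda>s. x + integral {0..s} (\<lambda>\<tau>. H (X n \<tau>)))" for n
    by (auto simp: X_def)
  have cX: "continuous_on {0..1} (X n)" for n
  proof (induction n)
    case (Suc n)
    have "continuous_on {0..1} (\<lambda>\<tau>. H (X n \<tau>))"
      by (rule continuous_on_compose2[OF Hc Suc]) auto
    then show ?case unfolding XS
      by (intro continuous_intros indefinite_integral_continuous_1 integrable_continuous_real)
  qed (simp add: X0)
  have cHX: "continuous_on {0..1} (\<lambda>\<tau>. H (X n \<tau>))" for n
    by (rule continuous_on_compose2[OF Hc cX]) auto
  have iHX: "(\<lambda>\<tau>. H (X n \<tau>)) integrable_on {0..s}" if "s \<in> {0..1}" for n s
    using that by (intro integrable_continuous_real continuous_on_subset[OF cHX]) auto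
  define B where "B = norm (H x)"
  have step: "norm (X (Suc n) s - X n s) \<le> B * (1/2)^n * exp (K * s)" if "s \<in> {0..1}" for n s
    using that
  proof (induction n arbitrary: s)
    case 0
    have "norm (X (Suc 0) s - X 0 s) = s * B"
      using 0 by (simp add: XS X0 B_def)
    also have "\<dots> \<le> exp (K * s) * B"
      using 0 K by (intro mult_right_mono) (auto simp: B_def intro: order_trans[of _ 1])
    finally show ?case by (simp add: mult.commute)
  next
    case (Suc n)
    \<comment> \<open>Integrating the weight gains a factor \<open>1 / K\<close>, and
      \<open>L / K \<le> 1 / 2\<close> yields the ratio of the geometric series.\<close>
    have exp_int: "((\<lambda>\<tau>. exp (K * \<tau>)) has_integral (exp (K * s) / K - exp (K * 0) / K)) {0..s}"
    proof (rule fundamental_theorem_of_calculus)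
      show "((\<lambda>\<tau>. exp (K * \<tau>) / K) has_vector_derivative exp (K * \<tau>)) (at \<tau> within {0..s})" for \<tau>
        unfolding has_real_derivative_iff_has_vector_derivative[symmetric]
        using K by (auto intro!: derivative_eq_intros)
    qed (use Suc.prems in auto)
    have bd_int: "((\<lambda>\<tau>. L * (B * (1/2)^n) * exp (K * \<tau>)) has_integral
        L * (B * (1/2)^n) * (exp (K * s) / K - exp (K * 0) / K)) {0..s}"
      using has_integral_mult_right[OF exp_int] .
    have "X (Suc (Suc n)) s - X (Suc n) s = integral {0..s} (\<lambda>\<tau>. H (X (Suc n) \<tau>)) - integral {0..s} (\<lambda>\<tau>. H (X n \<tau>))"
      by (simp add: XS)
    also have "\<dots> = integral {0..s} (\<lambda>\<tau>. H (X (Suc n) \<tau>) - H (X n \<tau>))"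
      using iHX[OF Suc.prems] by (simp add: integral_diff)
    finally have "norm (X (Suc (Suc n)) s - X (Suc n) s)
        = norm (integral {0..s} (\<lambda>\<tau>. H (X (Suc n) \<tau>) - H (X n \<tau>)))" by simp
    also have "\<dots> \<le> integral {0..s} (\<lambda>\<tau>. L * (B * (1/2)^n) * exp (K * \<tau>))"
    proof (rule integral_norm_bound_integral)
      show "(\<lambda>\<tau>. H (X (Suc n) \<tau>) - H (X n \<tau>)) integrable_on {0..s}"
        using iHX[OF Suc.prems] by (intro integrable_diff)
      show "(\<lambda>\<tau>. L * (B * (1/2)^n) * exp (K * \<tau>)) integrable_on {0..s}"
        using bd_int by blast
      fix \<tau> assume "\<tau> \<in> {0..s}"
      then have "norm (X (Suc n) \<tau> - X n \<tau>) \<le> B * (1/2)^n * exp (K * \<tau>)"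
        using Suc.IH[of \<tau>] Suc.prems by simp
      then have "L * norm (X (Suc n) \<tau> - X n \<tau>) \<le> L * (B * (1/2)^n * exp (K * \<tau>))"
        using L by (rule mult_left_mono)
      then show "norm (H (X (Suc n) \<tau>) - H (X n \<tau>)) \<le> L * (B * (1/2)^n) * exp (K * \<tau>)"
        using Hd[of "X (Suc n) \<tau>" "X n \<tau>"] by (simp add: mult.assoc)
    qed
    also have "\<dots> = L * (B * (1/2)^n) * (exp (K * s) / K - exp (K * 0) / K)"
      using bd_int by (rule integral_unique)
    also have "\<dots> \<le> L * (B * (1/2)^n) * (exp (K * s) / K)"
      using L K by (intro mult_left_mono) (auto simp: B_def)
    also have "\<dots> = (L / K) * (B * (1/2)^n * exp (K * s))" by simp
    also have "\<dots> \<le> (1/2) * (B * (1/2)^n * exp (K * s))"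
      using K L by (intro mult_right_mono) (auto simp: B_def field_simps)
    finally show ?case by simp
  qed
  have M: "norm (X (Suc n) s - X n s) \<le> (B * exp K) * (1/2)^n" if "s \<in> {0..1}" for n s
  proof -
    have "B * (1/2)^n * exp (K * s) \<le> B * (1/2)^n * exp K"
      using that K by (intro mult_left_mono) (auto simp: B_def)
    with step[OF that, of n] show ?thesis by (simp add: mult_ac)
  qed
  \<comment> \<open>The limit of the iterates as a telescoping series. Its terms have a geometric
    majorant independent of \<open>s\<close>, so convergence is uniform and passes under the
    integral.\<close>
  define \<gamma> where "\<gamma> = (\<lambda>s. x + suminf (\<lambda>n. X (Suc n) s - X n s))"
  have "uniform_limit {0..1} (\<lambda>n s. \<Sum>i<n. X (Suc i) s - X i s) (\<lambda>s. suminf (\<lambda>n. X (Suc n) s - X n s)) sequentially"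
    by (rule Weierstrass_m_test[OF M]) (auto intro!: summable_mult summable_geometric)
  then have "uniform_limit {0..1} (\<lambda>n s. x + (\<Sum>i<n. X (Suc i) s - X i s)) \<gamma> sequentially"
    unfolding \<gamma>_def by (intro uniform_limit_intros)
  moreover have "x + (\<Sum>i<n. X (Suc i) s - X i s) = X n s" for n s
    by (subst sum_lessThan_telescope) (simp add: X0)
  ultimately have ul: "uniform_limit {0..1} X \<gamma> sequentially" by simp
  have c\<gamma>: "continuous_on {0..1} \<gamma>"
    by (rule uniform_limit_theorem[OF _ ul]) (auto simp: cX)
  have cH\<gamma>: "continuous_on {0..1} (\<lambda>s. H (\<gamma> s))"
    by (rule continuous_on_compose2[OF Hc c\<gamma>]) auto
  have ulH: "uniform_limit {0..1} (\<lambda>n s. H (X n s)) (\<lambda>s. H (\<gamma> s)) sequentially"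
    by (rule uniform_limit_compose_uniformly_continuous_on[OF ul lipschitz_on_uniformly_continuous[OF H]])
      auto
  have eq: "\<gamma> s = x + integral {0..s} (\<lambda>\<tau>. H (\<gamma> \<tau>))" if s: "s \<in> {0..1}" for s
  proof -
    have "uniform_limit {0..s} (\<lambda>n s. H (X n s)) (\<lambda>s. H (\<gamma> s)) sequentially"
      by (rule uniform_limit_on_subset[OF ulH]) (use s in auto)
    then obtain I J where IJ: "\<And>n. ((\<lambda>\<tau>. H (X n \<tau>)) has_integral I n) {0..s}"
        "((\<lambda>s. H (\<gamma> s)) has_integral J) {0..s}" "I \<longlonglongrightarrow> J"
      using s by (elim uniform_limit_integral) (auto intro: continuous_on_subset[OF cHX])
    have "(\<lambda>n. X (Suc n) s) \<longlonglongrightarrow> x + J"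
    proof -
      have "X (Suc n) s = x + I n" for n
        using integral_unique[OF IJ(1)] by (simp add: XS)
      then show ?thesis using IJ(3) by (simp add: tendsto_add)
    qed
    moreover have "(\<lambda>n. X (Suc n) s) \<longlonglongrightarrow> \<gamma> s"
      using tendsto_uniform_limitI[OF ul s] by (rule LIMSEQ_Suc)
    ultimately show ?thesis using LIMSEQ_unique integral_unique[OF IJ(2)] by metis
  qed
  have "solves H \<gamma>"
    unfolding solves_def
  proof
    fix s :: real assume s: "s \<in> {0..1}"
    have "((\<lambda>s. x + integral {0..s} (\<lambda>\<tau>. H (\<gamma> \<tau>))) has_vector_derivative H (\<gamma> s)) (at s within {0..1})"
      using integral_has_vector_derivative[OF cH\<gamma> s] by (auto intro!: derivative_eq_intros)
    then show "(\<gamma> has_vector_derivative H (\<gamma> s)) (at s within {0..1})"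
      by (rule has_vector_derivative_transform[OF s, rotated]) (simp add: eq)
  qed
  moreover have "\<gamma> 0 = x" using eq[of 0] by simp
  ultimately show ?thesis by blast
qed

text \<open>The Lipschitz condition gives uniqueness, and linear growth excludes blow-up, so
  solutions from every point reach time one.\<close>

locale complete_field =
  fixes G :: "'e::euclidean_space \<Rightarrow> 'e" and C :: real
  assumes lip: "lipschitz_on_balls G"
    and growth: "\<And>e. norm (G e) \<le> C * (1 + norm e)"
begin

lemma C_nonneg: "0 \<le> C"
  using order_trans[OF norm_ge_zero growth[of 0]] by simp

text \<open>Along a solution, \<open>1 + \<bar>\<gamma>\<bar>^2\<close> has derivative at most
  \<open>2 C (\<bar>\<gamma>\<bar> + \<bar>\<gamma>\<bar>^2)\<close>, hence at most
  \<open>4 C\<close> times itself. A bound for this quantity also bounds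
  \<open>\<bar>\<gamma>\<bar>\<close>.\<close>

definition "escape r = exp (4 * C) * (1 + r\<^sup>2)"

text \<open>Stated for any \<open>H\<close> with the growth of \<open>G\<close>, because the
  existence proof applies it to a truncated field.\<close>

lemma solution_bound:
  fixes \<gamma> :: "real \<Rightarrow> 'e"
  assumes H: "\<And>e. norm (H e) \<le> C * (1 + norm e)" and \<gamma>: "solves H \<gamma>"
    and r: "norm (\<gamma> 0) \<le> r" and s: "s \<in> {0..1}"
  shows "norm (\<gamma> s) \<le> escape r"
proof -
  have aux: "2 * x \<le> 1 + z \<Longrightarrow> 0 \<le> z \<Longrightarrow> x + z \<le> 2 * (1 + z)" "2 * x \<le> 1 + z \<Longrightarrow> 0 \<le> z \<Longrightarrow> x \<le> 1 + z"
    for x z :: real by auto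
  have sq: "2 * x \<le> 1 + x\<^sup>2" for x :: real
    using zero_le_power2[of "x - 1"] by (simp add: power2_diff)
  have "1 + \<gamma> s \<bullet> \<gamma> s \<le> exp (4 * C * s) * (1 + \<gamma> 0 \<bullet> \<gamma> 0)"
  proof (rule gronwall_real[where \<phi> = "\<lambda>s. 1 + \<gamma> s \<bullet> \<gamma> s" and \<phi>' = "\<lambda>s. 2 * (\<gamma> s \<bullet> H (\<gamma> s))"])
    fix s :: real assume s: "s \<in> {0..1}"
    show "((\<lambda>s. 1 + \<gamma> s \<bullet> \<gamma> s) has_real_derivative 2 * (\<gamma> s \<bullet> H (\<gamma> s))) (at s within {0..1})"
      using \<gamma> s
      unfolding solves_def has_real_derivative_iff_has_vector_derivative has_vector_derivative_def
      by (auto intro!: derivative_eq_intros simp: fun_eq_iff inner_commute)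
    let ?n = "norm (\<gamma> s)"
    have "2 * ?n \<le> 1 + ?n\<^sup>2" by (rule sq)
    then have q: "?n + ?n\<^sup>2 \<le> 2 * (1 + ?n\<^sup>2)"
      by (rule aux(1)) simp
    have "\<gamma> s \<bullet> H (\<gamma> s) \<le> ?n * norm (H (\<gamma> s))" by (rule norm_cauchy_schwarz)
    also have "\<dots> \<le> ?n * (C * (1 + ?n))" using H by (intro mult_left_mono) auto
    also have "\<dots> = C * (?n + ?n\<^sup>2)" by (simp add: power2_eq_square algebra_simps)
    also have "\<dots> \<le> C * (2 * (1 + ?n\<^sup>2))"
      using C_nonneg q by (intro mult_left_mono)
    finally show "2 * (\<gamma> s \<bullet> H (\<gamma> s)) \<le> 4 * C * (1 + \<gamma> s \<bullet> \<gamma> s)"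
      by (simp add: power2_norm_eq_inner algebra_simps)
  qed (use s in auto)
  also have "\<dots> \<le> escape r"
    unfolding escape_def using C_nonneg s r
    by (intro mult_mono) (auto simp: power2_norm_eq_inner[symmetric] mult_left_le intro!: power_mono)
  finally have a: "1 + (norm (\<gamma> s))\<^sup>2 \<le> escape r" by (simp add: power2_norm_eq_inner)
  moreover have "norm (\<gamma> s) \<le> 1 + (norm (\<gamma> s))\<^sup>2"
    using sq by (rule aux(2)) simp
  ultimately show ?thesis by linarith
qed

text \<open>Both solutions stay in the ball of radius \<open>escape r\<close>, on which
  \<open>G\<close> has a single Lipschitz constant; Gronwall bounds their difference. That
  \<open>M\<close> depends on \<open>r\<close> only gives continuity of the flow as well as
  uniqueness.\<close>

lemma solution_dependence:
  "\<exists>M. \<forall>\<gamma> \<eta>. \<forall>s\<in>{0..1}. solves G \<gamma> \<longrightarrow> solves G \<eta> \<longrightarrow> norm (\<gamma> 0) \<le> r \<longrightarrow> norm (\<eta> 0) \<le> r \<longrightarrow>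
    norm (\<gamma> s - \<eta> s) \<le> M * norm (\<gamma> 0 - \<eta> 0)"
proof -
  obtain L where L: "0 \<le> L"
    "\<And>x y. norm x \<le> escape r \<Longrightarrow> norm y \<le> escape r \<Longrightarrow> norm (G x - G y) \<le> L * norm (x - y)"
    using lipschitz_on_ballsE[OF lip, of "escape r"] by blast
  show ?thesis
  proof (intro exI[of _ "exp L"] allI ballI impI)
    fix \<gamma> \<eta> s
    assume sol: "solves G \<gamma>" "solves G \<eta>" and r: "norm (\<gamma> 0) \<le> r" "norm (\<eta> 0) \<le> r"
      and s: "s \<in> {0..1::real}"
    have "norm (\<gamma> s - \<eta> s) \<le> exp (L * s) * norm (\<gamma> 0 - \<eta> 0)"
    proof (rule gronwall_norm[where e' = "\<lambda>s. G (\<gamma> s) - G (\<eta> s)"])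
      fix s :: real assume s: "s \<in> {0..1}"
      show "((\<lambda>s. \<gamma> s - \<eta> s) has_vector_derivative G (\<gamma> s) - G (\<eta> s)) (at s within {0..1})"
        using sol s unfolding solves_def by (auto intro: has_vector_derivative_diff)
      show "norm (G (\<gamma> s) - G (\<eta> s)) \<le> L * norm (\<gamma> s - \<eta> s)"
        using L(2) solution_bound[OF growth sol(1) r(1) s] solution_bound[OF growth sol(2) r(2) s]
        by blast
    qed (use s in auto)
    also have "\<dots> \<le> exp L * norm (\<gamma> 0 - \<eta> 0)"
      using L s by (intro mult_right_mono) (auto simp: mult_left_le)
    finally show "norm (\<gamma> s - \<eta> s) \<le> exp L * norm (\<gamma> 0 - \<eta> 0)" .
  qed
qed

lemma solution_unique:
  assumes "solves G \<gamma>" "solves G \<eta>" "\<gamma> 0 = \<eta> 0" "s \<in> {0..1}"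
  shows "\<gamma> s = \<eta> s"
proof -
  obtain M where "\<forall>\<gamma>' \<eta>. \<forall>s\<in>{0..1}. solves G \<gamma>' \<longrightarrow> solves G \<eta> \<longrightarrow> norm (\<gamma>' 0) \<le> norm (\<gamma> 0) \<longrightarrow>
      norm (\<eta> 0) \<le> norm (\<gamma> 0) \<longrightarrow> norm (\<gamma>' s - \<eta> s) \<le> M * norm (\<gamma>' 0 - \<eta> 0)"
    using solution_dependence[of "norm (\<gamma> 0)"] ..
  from this[rule_format, OF assms(4,1,2)] have "norm (\<gamma> s - \<eta> s) \<le> M * norm (\<gamma> 0 - \<eta> 0)"
    using assms(3) by simp
  then show ?thesis using assms(3) by simp
qed

text \<open>Composing \<open>G\<close> with the projection to a ball makes it globally Lipschitz, so
  that Picard iteration applies. The a priori bound keeps the solution inside the ball, where the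
  truncation changes nothing.\<close>

lemma solution_exists: "\<exists>\<gamma>. \<gamma> 0 = x \<and> solves G \<gamma>"
proof -
  define R where "R = escape (norm x)"
  have R: "0 \<le> R" by (simp add: R_def escape_def)
  define H where "H = (\<lambda>e. G (closest_point (cball 0 R) e))"
  obtain L where L: "L-lipschitz_on (cball 0 R) G" using lip unfolding lipschitz_on_balls_def by blast
  have "(L * 1)-lipschitz_on UNIV H"
    unfolding H_def
    using norm_closest_point_cball(2)[OF R]
    by (intro lipschitz_on_compose2 lipschitz_closest_point_cball[OF R] lipschitz_on_subset[OF L]) auto
  then obtain \<gamma> where \<gamma>: "\<gamma> 0 = x" "solves H \<gamma>" using picard by blast
  \<comment> \<open>Projection does not increase the norm, so the growth bound survives truncation
    with the same \<open>C\<close> and the radius \<open>R\<close> fixed beforehand is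
    valid.\<close>
  have "norm (H e) \<le> C * (1 + norm e)" for e
    unfolding H_def
    by (rule order_trans[OF growth mult_left_mono[OF add_left_mono C_nonneg]])
      (rule norm_closest_point_cball(1)[OF R])
  then have bound: "norm (\<gamma> s) \<le> R" if "s \<in> {0..1}" for s
    unfolding R_def using solution_bound \<gamma> that by blast
  have "H (\<gamma> s) = G (\<gamma> s)" if "s \<in> {0..1}" for s
    unfolding H_def norm_closest_point_cball(3)[OF R bound[OF that]] ..
  then have "solves G \<gamma>" using \<gamma>(2) unfolding solves_def by simp
  with \<gamma>(1) show ?thesis by blast
qed

text \<open>By uniqueness the choice affects only times outside the unit interval.\<close>

definition "flow x = (SOME \<gamma>. \<gamma> 0 = x \<and> solves G \<gamma>)"

lemma flow: "flow x 0 = x" "solves G (flow x)"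
  using someI_ex[OF solution_exists[of x]] unfolding flow_def by auto

lemma flow_unique: "solves G \<gamma> \<Longrightarrow> s \<in> {0..1} \<Longrightarrow> flow (\<gamma> 0) s = \<gamma> s"
  by (rule solution_unique) (auto simp: flow)

lemma continuous_flow: "continuous_on UNIV (\<lambda>x. flow x 1)"
proof -
  have "lipschitz_on_balls (\<lambda>x. flow x 1)"
  proof (rule lipschitz_on_ballsI)
    fix r :: real
    obtain M where M: "\<forall>\<gamma> \<eta>. \<forall>s\<in>{0..1}. solves G \<gamma> \<longrightarrow> solves G \<eta> \<longrightarrow> norm (\<gamma> 0) \<le> r \<longrightarrow>
        norm (\<eta> 0) \<le> r \<longrightarrow> norm (\<gamma> s - \<eta> s) \<le> M * norm (\<gamma> 0 - \<eta> 0)"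
      using solution_dependence[of r] ..
    have "norm (flow x 1 - flow y 1) \<le> M * norm (x - y)" if "norm x \<le> r" "norm y \<le> r" for x y
      using M[rule_format, of 1 "flow x" "flow y"] flow that by simp
    then show "\<exists>L. \<forall>x y. norm x \<le> r \<longrightarrow> norm y \<le> r \<longrightarrow> norm (flow x 1 - flow y 1) \<le> L * norm (x - y)" by blast
  qed
  then show ?thesis by (rule lipschitz_on_balls_continuous)
qed

end

subsection \<open>Local triviality under the Malgrange condition\<close>

text \<open>An explicit formula through which the adjoint of \<open>dF(x)\<close> inherits the
  regularity in \<open>x\<close> of \<open>dF(x)\<close>.\<close>

lemma adjoint_sum:
  fixes f :: "'v::euclidean_space \<Rightarrow> 'w::euclidean_space"
  assumes "linear f"
  shows "adjoint f w = (\<Sum>b\<in>Basis. (f b \<bullet> w) *\<^sub>R b)"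
proof (rule euclidean_eqI)
  fix b :: 'v assume b: "b \<in> Basis"
  have "adjoint f w \<bullet> b = f b \<bullet> w"
    using adjoint_works[OF assms, of b w] by (simp add: inner_commute)
  also have "\<dots> = (\<Sum>b\<in>Basis. (f b \<bullet> w) *\<^sub>R b) \<bullet> b"
    using b by (simp add: inner_sum_left inner_Basis if_distrib sum.delta cong: if_cong)
  finally show "adjoint f w \<bullet> b = (\<Sum>b\<in>Basis. (f b \<bullet> w) *\<^sub>R b) \<bullet> b" .
qed

text \<open>The inequality bounds the smallest singular value of \<open>dF(x)\<close> below by
  \<open>c / (1 + \<bar>x\<bar>)\<close> near the fibre over \<open>t\<close>. Velocities can
  therefore be lifted with at most linear growth.\<close>

locale malgrange =
  fixes F :: "'v::euclidean_space \<Rightarrow> 'w::euclidean_space" and F' :: "'v \<Rightarrow> 'v \<Rightarrow> 'w"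
    and t :: 'w and \<delta> c :: real
  assumes der: "\<And>x. (F has_derivative F' x) (at x)"
    and lip: "\<And>v. lipschitz_on_balls (\<lambda>x. F' x v)"
    and lipF: "lipschitz_on_balls F"
    and \<delta>: "0 < \<delta>" and c: "0 < c"
    and malgrange: "\<And>x w. norm (F x - t) < \<delta> \<Longrightarrow> c * norm w \<le> (1 + norm x) * norm (adjoint (F' x) w)"
begin

lemma linear: "linear (F' x)"
  using der has_derivative_linear by blast

definition D :: "'v \<Rightarrow> 'w \<Rightarrow> 'v" where
  "D x w = (\<Sum>b\<in>Basis. (F' x b \<bullet> w) *\<^sub>R b)"

text \<open>The distance from \<open>F x\<close> to the ball of radius \<open>\<delta> / 2\<close>
  about \<open>t\<close>. It is at least \<open>\<delta> / 2\<close> wherever the Malgrange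
  inequality is not assumed, so at every point one of the two gives control.\<close>

definition \<theta> :: "'v \<Rightarrow> real" where
  "\<theta> x = max 0 (norm (F x - t) - \<delta> / 2)"

text \<open>Over the ball of radius \<open>\<delta> / 2\<close> the map \<open>Q x\<close> is \<open>dF(x) dF(x)\<^sup>*\<close>; elsewhere \<open>\<theta>\<close> keeps it
  invertible, so that the field \<open>V\<close> is defined on the whole space.\<close>

definition Q :: "'v \<Rightarrow> 'w \<Rightarrow> 'w" where
  "Q x w = F' x (D x w) + \<theta> x *\<^sub>R w"

lemma adjoint_eq: "adjoint (F' x) w = D x w"
  unfolding D_def by (rule adjoint_sum[OF linear])

lemma F'_inner: "F' x v \<bullet> w = v \<bullet> D x w"
  using adjoint_works[OF linear] adjoint_eq by metis

lemma linear_D: "linear (D x)"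
  by (intro linearI) (simp_all add: D_def inner_add_right scaleR_add_left sum.distrib scaleR_sum_right)

lemma lip_D: "lipschitz_on_balls (\<lambda>x. D x w)"
  unfolding D_def
  by (intro lipschitz_on_balls_sum lipschitz_on_balls_bilinear[OF bounded_bilinear_scaleR]
      lipschitz_on_balls_bilinear[OF bounded_bilinear_inner] lip lipschitz_on_balls_const)

lemma linear_Q: "linear (Q x)"
proof -
  have "linear (\<lambda>w. F' x (D x w))" using linear_compose[OF linear_D linear] by (simp add: o_def)
  then show ?thesis
    unfolding Q_def[abs_def] by (intro linear_compose_add bounded_linear.linear[OF bounded_linear_scaleR_right])
qed

lemma lip_\<theta>: "lipschitz_on_balls \<theta>"
  unfolding \<theta>_def[abs_def]
  by (intro lipschitz_on_balls_max_norm lipschitz_on_balls_diff lipF lipschitz_on_balls_const)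

lemma lip_Q: "lipschitz_on_balls (\<lambda>x. Q x w)"
proof -
  have "lipschitz_on_balls (\<lambda>x. F' (fst (x, D x w)) (snd (x, D x w)))"
    by (rule lipschitz_on_balls_compose[OF lipschitz_on_balls_joint[OF linear lip]
          lipschitz_on_balls_Pair[OF lipschitz_on_balls_linear[OF bounded_linear_ident] lip_D]])
  then show ?thesis
    unfolding Q_def
    by (intro lipschitz_on_balls_add lipschitz_on_balls_bilinear[OF bounded_bilinear_scaleR] lip_\<theta>
        lipschitz_on_balls_const) simp
qed

lemma Q_inner: "Q x w \<bullet> w = (norm (D x w))\<^sup>2 + \<theta> x * (norm w)\<^sup>2"
  unfolding Q_def by (simp add: inner_add_left F'_inner power2_norm_eq_inner)

lemma \<theta>_nonneg: "0 \<le> \<theta> x" by (simp add: \<theta>_def)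

lemma Q_pos:
  assumes "w \<noteq> 0"
  shows "0 < Q x w \<bullet> w"
proof (cases "norm (F x - t) < \<delta>")
  case True
  have "0 < c * norm w" using c assms by simp
  also have "\<dots> \<le> (1 + norm x) * norm (D x w)" using malgrange[OF True] adjoint_eq by metis
  finally have "0 < norm (D x w)"
    by (smt (verit) norm_ge_zero zero_less_mult_iff)
  then show ?thesis unfolding Q_inner using \<theta>_nonneg by (intro add_pos_nonneg) auto
next
  case False
  then have "0 < \<theta> x" using \<delta> by (auto simp: \<theta>_def)
  then show ?thesis unfolding Q_inner using assms by (intro add_nonneg_pos) auto
qed

text \<open>The quadratic form of \<open>Q x\<close> attains a positive minimum on the compact
  product of a ball and the unit sphere; homogeneity in \<open>w\<close> does the rest. The radius
  \<open>\<bar>r\<bar>\<close> keeps that product nonempty.\<close>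

lemma Q_coercive:
  obtains a where "0 < a" "\<And>x w. norm x \<le> r \<Longrightarrow> a * norm w \<le> norm (Q x w)"
proof -
  have "continuous_on UNIV (\<lambda>p. Q (fst p) (snd p) \<bullet> snd p)"
    by (intro continuous_intros lipschitz_on_balls_continuous lipschitz_on_balls_joint linear_Q lip_Q)
  then have cont: "continuous_on (cball 0 \<bar>r\<bar> \<times> sphere 0 1) (\<lambda>p. Q (fst p) (snd p) \<bullet> snd p)"
    by (rule continuous_on_subset) simp
  have "compact (cball (0::'v) \<bar>r\<bar> \<times> sphere (0::'w) 1)" by (intro compact_Times) auto
  moreover have "cball (0::'v) \<bar>r\<bar> \<times> sphere (0::'w) 1 \<noteq> {}"
    using vector_choose_size[of 1, where 'a = 'w] by auto
  ultimately obtain p where p: "p \<in> cball 0 \<bar>r\<bar> \<times> sphere 0 1"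
    "\<And>q. q \<in> cball 0 \<bar>r\<bar> \<times> sphere 0 1 \<Longrightarrow> Q (fst p) (snd p) \<bullet> snd p \<le> Q (fst q) (snd q) \<bullet> snd q"
    using continuous_attains_inf[OF _ _ cont] by blast
  let ?a = "Q (fst p) (snd p) \<bullet> snd p"
  show ?thesis
  proof (rule that[of ?a])
    show "0 < ?a" using p(1) by (intro Q_pos) auto
    fix x :: 'v and w :: 'w assume x: "norm x \<le> r"
    show "?a * norm w \<le> norm (Q x w)"
    proof (cases "w = 0")
      case False
      let ?w = "w /\<^sub>R norm w"
      have "?a \<le> Q x ?w \<bullet> ?w" using p(2)[of "(x, ?w)"] x False by auto
      also have "\<dots> \<le> norm (Q x ?w) * norm ?w" by (rule norm_cauchy_schwarz)
      also have "\<dots> = norm (Q x w) / norm w"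
        using False by (simp add: linear_cmul[OF linear_Q] divide_inverse mult.commute)
      finally show ?thesis using False by (simp add: field_simps)
    qed (simp add: linear_0[OF linear_Q])
  qed
qed

lemma bij_Q: "bij (Q x)"
proof -
  have "inj (Q x)"
    using Q_pos[of _ x] by (subst linear_injective_0[OF linear_Q]) (metis inner_zero_left less_irrefl)
  then show ?thesis using linear_injective_imp_surjective[OF linear_Q] by (simp add: bij_def)
qed

text \<open>\<open>V x y\<close> is the regularised least squares solution of
  \<open>dF(x) v = y\<close> with parameter \<open>\<theta> x\<close>. Over the ball of radius
  \<open>\<delta> / 2\<close>, where the parameter vanishes, it is the shortest exact
  solution.\<close>

definition "u x y = inv (Q x) y"
definition "V x y = D x (u x y)"

lemma Q_u: "Q x (u x y) = y"
  unfolding u_def using bij_Q by (simp add: bij_is_surj surj_f_inv_f)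

lemma u_eqI: "Q x w = y \<Longrightarrow> u x y = w"
  unfolding u_def using bij_Q by (simp add: bij_is_inj inv_f_eq)

lemma F'_V: "F' x (V x y) = y - \<theta> x *\<^sub>R u x y"
  using Q_u[of x y] unfolding Q_def V_def by (simp add: algebra_simps)

text \<open>Reversing time along a lift thus amounts to negating the displacement.\<close>

lemma V_minus: "V x (- y) = - V x y"
proof -
  have "u x (- y) = - u x y" by (rule u_eqI) (simp add: linear_neg[OF linear_Q] Q_u)
  then show ?thesis unfolding V_def by (simp add: linear_neg[OF linear_D])
qed

text \<open>Pairing \<open>Q x u = y\<close> with \<open>u\<close> gives \<open>\<bar>V\<bar>^2 +
  \<theta> \<bar>u\<bar>^2 \<le> \<bar>y\<bar> \<bar>u\<bar>\<close>. Then \<open>u\<close> is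
  bounded through \<open>V\<close> by the Malgrange inequality, which yields \<open>1 / c\<close>,
  or through \<open>y\<close> where \<open>\<theta> \<ge> \<delta> / 2\<close>, which yields
  \<open>sqrt (2 / \<delta>)\<close>.\<close>

lemma V_growth: "norm (V x y) \<le> (1 / c + sqrt (2 / \<delta>)) * (1 + norm x) * norm y"
proof -
  let ?V = "V x y" and ?u = "u x y"
  have eq: "(norm ?V)\<^sup>2 + \<theta> x * (norm ?u)\<^sup>2 = y \<bullet> ?u"
    using Q_inner[of x ?u] unfolding Q_u V_def by simp
  have le: "y \<bullet> ?u \<le> norm y * norm ?u" by (rule norm_cauchy_schwarz)
  consider "norm (F x - t) < \<delta>" | "\<delta> / 2 \<le> \<theta> x" 
    by (cases "norm (F x - t) < \<delta>") (auto simp: \<theta>_def max_def)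
  then show ?thesis
  proof cases
    case 1
    have "norm ?u * c \<le> (1 + norm x) * norm ?V"
      using malgrange[OF 1, of ?u] unfolding adjoint_eq V_def by (simp add: mult.commute)
    then have "norm ?u \<le> (1 + norm x) * norm ?V / c" using c by (simp add: field_simps)
    then have "norm y * norm ?u \<le> norm y * ((1 + norm x) * norm ?V / c)" by (rule mult_left_mono) simp
    moreover have "0 \<le> \<theta> x * (norm ?u)\<^sup>2" using \<theta>_nonneg by simp
    ultimately have sq: "norm ?V * norm ?V \<le> (1 / c * (1 + norm x) * norm y) * norm ?V"
      using eq le by (simp add: power2_eq_square mult_ac)
    have "norm ?V \<le> 1 / c * (1 + norm x) * norm y"
    proof (cases "?V = 0")
      case False
      then show ?thesis by (intro mult_right_le_imp_le[OF sq]) simp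
    qed (use c in simp)
    also have "\<dots> \<le> (1 / c + sqrt (2 / \<delta>)) * (1 + norm x) * norm y"
      using \<delta> by (intro mult_right_mono) auto
    finally show ?thesis .
  next
    case 2
    have "\<delta> / 2 * (norm ?u)\<^sup>2 \<le> \<theta> x * (norm ?u)\<^sup>2" using 2 by (rule mult_right_mono) simp
    then have "\<delta> / 2 * norm ?u * norm ?u \<le> norm y * norm ?u"
      using eq le zero_le_power2[of "norm ?V"] unfolding power2_eq_square by linarith
    then have "\<delta> / 2 * norm ?u \<le> norm y"
      using \<delta> by (cases "norm ?u = 0") (auto simp: mult_le_cancel_right)
    then have "norm ?u \<le> 2 / \<delta> * norm y" using \<delta> by (simp add: field_simps)
    then have "norm y * norm ?u \<le> norm y * (2 / \<delta> * norm y)" by (rule mult_left_mono) simp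
    moreover have "0 \<le> \<theta> x * (norm ?u)\<^sup>2" using \<theta>_nonneg by simp
    moreover have "norm y * (2 / \<delta> * norm y) = (sqrt (2 / \<delta>) * norm y)\<^sup>2"
      using \<delta> by (simp add: power_mult_distrib power2_eq_square[of "norm y"])
    ultimately have "(norm ?V)\<^sup>2 \<le> (sqrt (2 / \<delta>) * norm y)\<^sup>2"
      using eq le by linarith
    then have "norm ?V \<le> sqrt (2 / \<delta>) * norm y" by (rule power2_le_imp_le) (use \<delta> in simp)
    also have "\<dots> \<le> (1 / c + sqrt (2 / \<delta>)) * (1 + norm x) * norm y"
      using \<delta> c by (intro mult_right_mono) (auto simp: algebra_simps)
    finally show ?thesis .
  qed
qed

text \<open>With \<open>u = u x y\<close> and \<open>v = u x' y'\<close>, the identity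
  \<open>Q x (u - v) = (y - y') + (Q x' v - Q x v)\<close> bounds \<open>Q x (u - v)\<close>, and
  coercivity carries the bound over to \<open>u - v\<close>.\<close>

lemma lip_u: "lipschitz_on_balls (\<lambda>p. u (fst p) (snd p))"
proof (rule lipschitz_on_ballsI)
  fix r :: real assume r: "0 \<le> r"
  obtain a where a: "0 < a" "\<And>x w. norm x \<le> r \<Longrightarrow> a * norm w \<le> norm (Q x w)"
    using Q_coercive by blast
  \<comment> \<open>Coercivity gives \<open>\<bar>u x' y'\<bar> \<le> r / a\<close>, so the pairs at
    which \<open>Q\<close> is compared have norm at most \<open>R\<close>.\<close>
  define R where "R = r + r / a"
  obtain L where L: "0 \<le> L"
    "\<And>p q. norm p \<le> R \<Longrightarrow> norm q \<le> R \<Longrightarrow>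
      norm (Q (fst p) (snd p) - Q (fst q) (snd q)) \<le> L * norm (p - q)"
    using lipschitz_on_ballsE[OF lipschitz_on_balls_joint[OF linear_Q lip_Q], of R] by blast
  have main: "norm (u x y - u x' y') \<le> (1 + L) / a * norm ((x, y) - (x', y'))"
    if xy: "norm (x, y) \<le> r" "norm (x', y') \<le> r" for x y x' y'
  proof -
    let ?u = "u x y" and ?v = "u x' y'"
    have n: "norm x \<le> r" "norm x' \<le> r" "norm y' \<le> r"
      using xy norm_fst_le[of x y] norm_fst_le[of x' y'] norm_snd_le[of y' x'] by auto
    have "a * norm ?v \<le> r" using a(2)[OF n(2), of ?v] n(3) by (simp add: Q_u)
    then have v: "norm ?v \<le> r / a" using a(1) by (simp add: field_simps)
    have nr: "norm (x, ?v) \<le> R" "norm (x', ?v) \<le> R"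
      using n v norm_Pair_le[of x ?v] norm_Pair_le[of x' ?v] by (auto simp: R_def)
    have "a * norm (?u - ?v) \<le> norm (Q x (?u - ?v))" using a(2)[OF n(1)] .
    also have "Q x (?u - ?v) = (y - y') + (Q x' ?v - Q x ?v)"
      by (simp add: linear_diff[OF linear_Q] Q_u)
    also have "norm \<dots> \<le> norm (y - y') + norm (Q x' ?v - Q x ?v)" by (rule norm_triangle_ineq)
    also have "\<dots> \<le> norm (y - y') + L * norm (x' - x)"
      using L(2)[OF nr(2,1)] by (simp add: norm_Pair)
    also have "\<dots> \<le> norm ((x, y) - (x', y')) + L * norm ((x, y) - (x', y'))"
      using norm_fst_le[of "x - x'" "y - y'"] norm_snd_le[of "y - y'" "x - x'"] L(1)
      by (intro add_mono mult_left_mono) (auto simp: norm_minus_commute)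
    finally show ?thesis using a(1) by (simp add: field_simps)
  qed
  show "\<exists>L. \<forall>p q. norm p \<le> r \<longrightarrow> norm q \<le> r \<longrightarrow>
      norm (u (fst p) (snd p) - u (fst q) (snd q)) \<le> L * norm (p - q)"
  proof (intro exI allI impI)
    fix p q :: "'v \<times> 'w" assume "norm p \<le> r" "norm q \<le> r"
    then show "norm (u (fst p) (snd p) - u (fst q) (snd q)) \<le> (1 + L) / a * norm (p - q)"
      using main[of "fst p" "snd p" "fst q" "snd q"] by simp
  qed
qed

lemma lip_V: "lipschitz_on_balls (\<lambda>p. V (fst p) (snd p))"
proof -
  have "lipschitz_on_balls (\<lambda>p. D (fst (fst p, u (fst p) (snd p))) (snd (fst p, u (fst p) (snd p))))"
    by (rule lipschitz_on_balls_compose[OF lipschitz_on_balls_joint[OF linear_D lip_D]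
          lipschitz_on_balls_Pair[OF lipschitz_on_balls_fst lip_u]])
  then show ?thesis by (simp add: V_def)
qed

text \<open>The bound on \<open>V x y\<close> is a product of terms in \<open>x\<close> and
  \<open>y\<close>; truncating \<open>y\<close> makes it linear in the whole state.\<close>

definition clip :: "'w \<Rightarrow> 'w" where
  "clip = closest_point (cball 0 (\<delta> / 2))"

text \<open>The displacement is a constant component of the state: one autonomous field lifts all
  segments, and continuity of the flow gives joint continuity of the lift in point and
  displacement.\<close>

definition G :: "'v \<times> 'w \<Rightarrow> 'v \<times> 'w" where
  "G p = (V (fst p) (clip (snd p)), 0)"

sublocale complete_field G "(1 / c + sqrt (2 / \<delta>)) * (\<delta> / 2)"
proof
  have d: "0 \<le> \<delta> / 2" using \<delta> by simp
  have "lipschitz_on_balls clip"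
    unfolding clip_def by (rule lipschitz_on_balls_global[OF lipschitz_closest_point_cball[OF d]])
  then have "lipschitz_on_balls (\<lambda>p :: 'v \<times> 'w. (fst p, clip (snd p)))"
    by (intro lipschitz_on_balls_Pair lipschitz_on_balls_fst
        lipschitz_on_balls_compose[OF _ lipschitz_on_balls_snd])
  from lipschitz_on_balls_compose[OF lip_V this] show "lipschitz_on_balls G"
    unfolding G_def[abs_def] by (intro lipschitz_on_balls_Pair lipschitz_on_balls_const) simp
  show "norm (G e) \<le> (1 / c + sqrt (2 / \<delta>)) * (\<delta> / 2) * (1 + norm e)" for e
  proof -
    have "norm (G e) = norm (V (fst e) (clip (snd e)))" by (simp add: G_def norm_Pair)
    also have "\<dots> \<le> (1 / c + sqrt (2 / \<delta>)) * (1 + norm (fst e)) * norm (clip (snd e))"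
      by (rule V_growth)
    also have "\<dots> \<le> (1 / c + sqrt (2 / \<delta>)) * (1 + norm e) * (\<delta> / 2)"
      using norm_fst_le[of "fst e" "snd e"] norm_closest_point_cball(2)[OF d, of "snd e"] c \<delta>
      by (intro mult_mono) (auto simp: clip_def)
    finally show ?thesis by (simp add: mult_ac)
  qed
qed

definition "lift x y s = fst (flow (x, y) s)"

lemma flow_eq:
  assumes y: "norm y \<le> \<delta> / 2" and s: "s \<in> {0..1}"
  shows "flow (x, y) s = (lift x y s, y)"
    and "(lift x y has_vector_derivative V (lift x y s) y) (at s within {0..1})"
proof -
  have der: "(flow (x, y) has_vector_derivative G (flow (x, y) s)) (at s within {0..1})"
    if "s \<in> {0..1}" for s
    using flow(2)[of "(x, y)"] that unfolding solves_def by blast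
  have snd: "snd (flow (x, y) s) = y" if s: "s \<in> {0..1}" for s
  proof -
    \<comment> \<open>Gronwall with constant zero: a component with vanishing derivative keeps its
      initial value.\<close>
    have "norm (snd (flow (x, y) s) - y) \<le> exp (0 * s) * norm (snd (flow (x, y) 0) - y)"
    proof (rule gronwall_norm[where e' = "\<lambda>s. 0"])
      show "((\<lambda>s. snd (flow (x, y) s) - y) has_vector_derivative 0) (at s within {0..1})"
        if "s \<in> {0..1}" for s
        using bounded_linear.has_vector_derivative[OF bounded_linear_snd der[OF that]]
        by (auto simp: G_def intro!: derivative_eq_intros)
    qed (use s in auto)
    then show ?thesis by (simp add: flow(1))
  qed
  show eq: "flow (x, y) s = (lift x y s, y)"
    using snd[OF s] by (simp add: lift_def prod_eq_iff)
  have "clip y = y" unfolding clip_def using y \<delta> by (intro norm_closest_point_cball(3)) auto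
  then show "(lift x y has_vector_derivative V (lift x y s) y) (at s within {0..1})"
    using bounded_linear.has_vector_derivative[OF bounded_linear_fst der[OF s]]
    by (simp add: lift_def[abs_def] G_def snd[OF s])
qed

lemma lift_0: "lift x y 0 = x"
  by (simp add: lift_def flow(1))

text \<open>The deviation \<open>e\<close> of \<open>F\<close> along the lift from the segment satisfies \<open>\<bar>e'\<bar> \<le> C \<bar>e\<bar>\<close>, since
  the defect \<open>\<theta>\<close> is bounded by the distance to the ball, which contains the segment.\<close>

lemma F_lift:
  assumes y: "norm y \<le> \<delta> / 2" and x: "norm (F x - t) \<le> \<delta> / 2" "norm (F x + y - t) \<le> \<delta> / 2"
    and s: "s \<in> {0..1}"
  shows "F (lift x y s) = F x + s *\<^sub>R y"
proof -
  let ?\<gamma> = "lift x y"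
  have "continuous_on {0..1} ?\<gamma>"
    using flow_eq(2)[OF y] by (rule continuous_on_vector_derivative)
  then have cont: "continuous_on {0..1} (\<lambda>s. u (?\<gamma> s) y)"
    using continuous_on_compose2[OF lipschitz_on_balls_continuous[OF lip_u], of "{0..1}" "\<lambda>s. (?\<gamma> s, y)"]
    by (simp add: continuous_on_Pair)
  \<comment> \<open>The lifted path is compact, so \<open>u\<close> is bounded along it;
    \<open>B\<close> becomes the constant in Gronwall's inequality.\<close>
  then have "bounded ((\<lambda>s. u (?\<gamma> s) y) ` {0..1})"
    by (intro compact_imp_bounded compact_continuous_image) auto
  then obtain B where "\<forall>z\<in>(\<lambda>s. u (?\<gamma> s) y) ` {0..1}. norm z \<le> B"
    unfolding bounded_iff ..
  then have B: "norm (u (?\<gamma> s) y) \<le> B" if "s \<in> {0..1}" for s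
    using that by blast
  let ?e = "\<lambda>s. F (?\<gamma> s) - (F x + s *\<^sub>R y)"
  have "norm (?e s) \<le> exp (B * s) * norm (?e 0)"
  proof (rule gronwall_norm[where e' = "\<lambda>s. - (\<theta> (?\<gamma> s) *\<^sub>R u (?\<gamma> s) y)"])
    fix s :: real assume s: "s \<in> {0..1}"
    have "((\<lambda>s. F (?\<gamma> s)) has_vector_derivative F' (?\<gamma> s) (V (?\<gamma> s) y)) (at s within {0..1})"
      using vector_derivative_diff_chain_within[OF flow_eq(2)[OF y s] has_derivative_at_withinI[OF der]]
      by (simp add: o_def)
    then show "(?e has_vector_derivative - (\<theta> (?\<gamma> s) *\<^sub>R u (?\<gamma> s) y)) (at s within {0..1})"
      unfolding F'_V by (auto intro!: derivative_eq_intros)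
    \<comment> \<open>Both ends of the segment lie in the ball, hence so does the whole
      segment.\<close>
    have "F x + s *\<^sub>R y - t \<in> cball 0 (\<delta> / 2)"
    proof -
      have "(1 - s) *\<^sub>R (F x - t) + s *\<^sub>R (F x + y - t) \<in> cball 0 (\<delta> / 2)"
        using x s by (intro convexD_alt[OF convex_cball]) auto
      then show ?thesis by (simp add: algebra_simps)
    qed
    moreover have "norm (F (?\<gamma> s) - t) \<le> norm (?e s) + norm (F x + s *\<^sub>R y - t)"
      by (rule norm_triangle_sub[of "F (?\<gamma> s) - t" "F x + s *\<^sub>R y - t", simplified add.commute, THEN order_trans])
        (simp add: algebra_simps)
    ultimately have "\<theta> (?\<gamma> s) \<le> norm (?e s)" by (simp add: \<theta>_def)
    then have "\<theta> (?\<gamma> s) * norm (u (?\<gamma> s) y) \<le> norm (?e s) * B"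
      using B[OF s] \<theta>_nonneg by (intro mult_mono) auto
    then show "norm (- (\<theta> (?\<gamma> s) *\<^sub>R u (?\<gamma> s) y)) \<le> B * norm (?e s)"
      using \<theta>_nonneg by (simp add: mult.commute)
  qed (use s in auto)
  then show ?thesis by (simp add: lift_0)
qed

text \<open>The reversed lift, paired with \<open>- y\<close>, solves the same equation because
  \<open>V\<close> is odd in the displacement; uniqueness identifies it with the lift of
  \<open>- y\<close> from the endpoint.\<close>

lemma lift_reverse:
  assumes y: "norm y \<le> \<delta> / 2"
  shows "lift (lift x y 1) (- y) 1 = x"
proof -
  have "solves G (\<lambda>s. (lift x y (1 - s), - y))"
    unfolding solves_def
  proof
    fix s :: real assume s: "s \<in> {0..1}"
    have "((lift x y \<circ> (\<lambda>s. 1 - s)) has_vector_derivative (- 1) *\<^sub>R V (lift x y (1 - s)) y) (at s within {0..1})"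
    proof (rule vector_diff_chain_within)
      show "((\<lambda>s. 1 - s) has_vector_derivative - 1) (at s within {0..1})"
        by (auto intro!: derivative_eq_intros)
      have "(\<lambda>s. 1 - s) ` {0..1} = {0..1::real}" by force
      then show "(lift x y has_vector_derivative V (lift x y (1 - s)) y)
          (at (1 - s) within (\<lambda>s. 1 - s) ` {0..1})"
        using flow_eq(2)[OF y, of "1 - s"] s by simp
    qed
    moreover have "clip (- y) = - y"
      unfolding clip_def using y \<delta> by (intro norm_closest_point_cball(3)) auto
    ultimately show "((\<lambda>s. (lift x y (1 - s), - y)) has_vector_derivative
        G (lift x y (1 - s), - y)) (at s within {0..1})"
      by (auto simp: G_def V_minus o_def intro!: has_vector_derivative_Pair)
  qed
  from flow_unique[OF this, of 1] show ?thesis by (simp add: lift_def[of "lift x y 1"] lift_0)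
qed

lemma continuous_lift:
  assumes "continuous_on S f" "continuous_on S g"
  shows "continuous_on S (\<lambda>p. lift (f p) (g p) 1)"
  unfolding lift_def
  by (intro continuous_on_fst continuous_on_compose2[OF continuous_flow] continuous_on_Pair assms) auto

text \<open>Each \<open>x\<close> is transported to the fibre over \<open>t\<close> by lifting the
  segment from \<open>F x\<close> to \<open>t\<close>. The inverse lifts the opposite
  segment.\<close>

theorem trivial_near:
  "\<exists>h h'. homeomorphism (F -` ball t (\<delta> / 2)) (ball t (\<delta> / 2) \<times> F -` {t}) h h' \<and>
     (\<forall>x\<in>F -` ball t (\<delta> / 2). fst (h x) = F x)"
proof -
  let ?U = "ball t (\<delta> / 2)"
  let ?h = "\<lambda>x. (F x, lift x (t - F x) 1)" and ?h' = "\<lambda>p. lift (snd p) (fst p - t) 1"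
  have U: "norm (t - z) \<le> \<delta> / 2" "norm (z - t) \<le> \<delta> / 2" if "z \<in> ?U" for z
    using that by (auto simp: dist_norm norm_minus_commute)
  have h: "F (lift x (t - F x) 1) = t" if "x \<in> F -` ?U" for x
    using F_lift[of "t - F x" x 1] U[of "F x"] that \<delta> by simp
  have h': "F (lift x (z - t) 1) = z" if "z \<in> ?U" "F x = t" for z x
    using F_lift[of "z - t" x 1] U[of z] that \<delta> by simp
  have cF: "continuous_on S F" for S
    using lipschitz_on_balls_continuous[OF lipF] by (rule continuous_on_subset) simp
  have "homeomorphism (F -` ?U) (?U \<times> F -` {t}) ?h ?h'"
  proof (rule homeomorphismI)
    show "continuous_on (F -` ?U) ?h"
      by (intro continuous_on_Pair continuous_lift continuous_intros cF)
    show "continuous_on (?U \<times> F -` {t}) ?h'"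
      by (intro continuous_lift continuous_intros)
    show "?h ` (F -` ?U) \<subseteq> ?U \<times> F -` {t}" using h by auto
    show "?h' ` (?U \<times> F -` {t}) \<subseteq> F -` ?U" using h' by auto
    show "?h' (?h x) = x" if "x \<in> F -` ?U" for x
      using lift_reverse[of "t - F x" x] U[of "F x"] that by simp
    show "?h (?h' p) = p" if "p \<in> ?U \<times> F -` {t}" for p
      using lift_reverse[of "fst p - t" "snd p"] U[of "fst p"] h'[of "fst p" "snd p"] that
      by (auto simp: mem_Times_iff)
  qed
  then show ?thesis by (intro exI[of _ ?h] exI[of _ ?h']) simp
qed

end

subsection \<open>Growth directions of sequences\<close>

text \<open>Extended real sequences always have convergent subsequences; these are extracted for one
  element of \<open>U\<close> after the other.\<close>

lemma finite_subsequence_ereal: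
  fixes g :: "'u \<Rightarrow> nat \<Rightarrow> ereal"
  assumes "finite U"
  shows "\<exists>r. strict_mono r \<and> (\<forall>u\<in>U. \<exists>l. (g u \<circ> r) \<longlonglongrightarrow> l)"
  using assms
proof induction
  case empty
  show ?case by (auto intro: exI[of _ id] strict_mono_id)
next
  case (insert u U)
  then obtain r where r: "strict_mono r" "\<forall>u\<in>U. \<exists>l. (g u \<circ> r) \<longlonglongrightarrow> l" by blast
  obtain l s where s: "strict_mono s" "((g u \<circ> r) \<circ> s) \<longlonglongrightarrow> l"
    using compact_complete_linorder[of "g u \<circ> r"] by blast
  have "\<exists>l. (g w \<circ> (r \<circ> s)) \<longlonglongrightarrow> l" if "w \<in> insert u U" for w
  proof (cases "w = u")
    case True
    then show ?thesis using s(2) unfolding comp_assoc by blast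
  next
    case False
    with that have "w \<in> U" by simp
    from bspec[OF r(2) this] obtain m where "(g w \<circ> r) \<longlonglongrightarrow> m" ..
    from LIMSEQ_subseq_LIMSEQ[OF this s(1)] show ?thesis unfolding comp_assoc by blast
  qed
  then show ?case using strict_mono_o[OF r(1) s(1)] by blast
qed

text \<open>This replaces the curve selection lemma: \<open>p\<close> plays the role of the vector of leading exponents
  of a curve.\<close>

lemma asymptotic_direction:
  fixes L :: "nat \<Rightarrow> 'e::euclidean_space" and U :: "'e set"
  assumes U: "finite U"
  obtains r p \<alpha> where "strict_mono r" "convergent \<alpha>"
    "\<And>u n. u \<in> U \<Longrightarrow> p \<bullet> u = 0 \<Longrightarrow> (L (r n) - \<alpha> n) \<bullet> u = 0"
    "\<And>u. u \<in> U \<Longrightarrow> p \<bullet> u > 0 \<Longrightarrow> filterlim (\<lambda>n. (L (r n) - \<alpha> n) \<bullet> u) at_top sequentially"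
    "\<And>u. u \<in> U \<Longrightarrow> p \<bullet> u < 0 \<Longrightarrow> filterlim (\<lambda>n. (L (r n) - \<alpha> n) \<bullet> u) at_bot sequentially"
proof -
  obtain r where r: "strict_mono r"
    and lim: "\<forall>u\<in>U. \<exists>l. ((\<lambda>n. ereal (L n \<bullet> u)) \<circ> r) \<longlonglongrightarrow> l"
    using finite_subsequence_ereal[OF U, of "\<lambda>u n. ereal (L n \<bullet> u)"] by blast
  define R where "R = (\<lambda>n. L (r n))"
  have tri: "convergent (\<lambda>n. R n \<bullet> u) \<or> filterlim (\<lambda>n. R n \<bullet> u) at_top sequentially \<or>
      filterlim (\<lambda>n. R n \<bullet> (- u)) at_top sequentially" if "u \<in> U" for u
  proof -
    from bspec[OF lim \<open>u \<in> U\<close>] obtain l where l: "(\<lambda>n. ereal (R n \<bullet> u)) \<longlonglongrightarrow> l"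
      unfolding R_def o_def ..
    show ?thesis
    proof (cases l)
      case (real x)
      then show ?thesis using l by (auto simp: convergent_def)
    next
      case PInf
      then show ?thesis using l by (simp add: tendsto_PInfty_eq_at_top)
    next
      case MInf
      then have "(\<lambda>n. - ereal (R n \<bullet> u)) \<longlonglongrightarrow> - (- \<infinity>)"
        using l by (intro tendsto_uminus_ereal) simp
      then have "(\<lambda>n. ereal (R n \<bullet> (- u))) \<longlonglongrightarrow> \<infinity>" by simp
      then show ?thesis unfolding tendsto_PInfty_eq_at_top by blast
    qed
  qed
  \<comment> \<open>Each \<open>u\<close> in \<open>U\<close> lies in \<open>Z\<close> or, up to
    sign, in \<open>P\<close>. The desired \<open>p\<close> vanishes on \<open>Z\<close> and is
    positive on \<open>P\<close>.\<close>
  define Z where "Z = {u \<in> U. convergent (\<lambda>n. R n \<bullet> u)}"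
  define P where "P = {u \<in> U \<union> uminus ` U. filterlim (\<lambda>n. R n \<bullet> u) at_top sequentially}"
  have span: "convergent (\<lambda>n. R n \<bullet> v)" if "v \<in> span Z" for v
    using that
  proof (induction rule: span_induct_alt)
    case base
    then show ?case by (simp add: convergent_const)
  next
    case (step c x y)
    then have "convergent (\<lambda>n. c * (R n \<bullet> x) + R n \<bullet> y)"
      by (intro convergent_add convergent_mult convergent_const) (auto simp: Z_def)
    then show ?case by (simp add: inner_add_right)
  qed
  obtain B where B: "B \<subseteq> span Z" "pairwise orthogonal B" "\<And>x. x \<in> B \<Longrightarrow> norm x = 1"
      "independent B" "span B = span Z"
    using orthonormal_basis_subspace[OF subspace_span[of Z]] by metis
  have fB: "finite B" using B(4) by (rule independent_imp_finite)
  \<comment> \<open>The orthogonal projection of \<open>R n\<close> to the span of \<open>Z\<close>.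
    It converges, and subtracting it makes the pairings with \<open>Z\<close> vanish exactly rather
    than merely converge.\<close>
  define \<alpha> where "\<alpha> = (\<lambda>n. \<Sum>b\<in>B. (R n \<bullet> b) *\<^sub>R b)"
  have conv: "convergent \<alpha>"
  proof -
    have "\<exists>l. (\<lambda>n. R n \<bullet> b) \<longlonglongrightarrow> l" if "b \<in> B" for b
      using span[of b] B(1) that unfolding convergent_def by blast
    then obtain l where "\<And>b. b \<in> B \<Longrightarrow> (\<lambda>n. R n \<bullet> b) \<longlonglongrightarrow> l b" by metis
    then have "\<alpha> \<longlonglongrightarrow> (\<Sum>b\<in>B. l b *\<^sub>R b)" unfolding \<alpha>_def by (intro tendsto_intros)
    then show ?thesis by (rule convergentI)
  qed
  have orth: "(R n - \<alpha> n) \<bullet> v = 0" if "v \<in> span Z" for v n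
  proof -
    have "(R n - \<alpha> n) \<bullet> b = 0" if b: "b \<in> B" for b
    proof -
      have "\<alpha> n \<bullet> b = (\<Sum>b'\<in>B. if b' = b then R n \<bullet> b else 0)"
        unfolding \<alpha>_def inner_sum_left
        using B(2) B(3)[OF b] b
        by (intro sum.cong) (auto simp: pairwise_def orthogonal_def dot_square_norm)
      then show ?thesis using fB b by (simp add: inner_diff_left)
    qed
    moreover have "v \<in> span B" using that B(5) by simp
    ultimately show ?thesis
      by (metis (no_types, lifting) orthogonal_def orthogonal_to_span)
  qed
  \<comment> \<open>A vector common to \<open>span Z\<close> and the convex hull of \<open>P\<close>
    would have a pairing with \<open>R n\<close> that both converges and tends to infinity. So the
    subspace and the compact hull can be strictly separated; for empty \<open>P\<close> the zero
    vector serves.\<close>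
  have "\<exists>p. (\<forall>v\<in>span Z. p \<bullet> v = 0) \<and> (\<forall>u\<in>P. 0 < p \<bullet> u)"
  proof (cases "P = {}")
    case False
    have fP: "finite P" unfolding P_def using U by simp
    have top: "filterlim (\<lambda>n. R n \<bullet> v) at_top sequentially" if "v \<in> convex hull P" for v
    proof -
      have "convex {v. filterlim (\<lambda>n. R n \<bullet> v) at_top sequentially}"
        unfolding convex_alt
      proof clarify
        fix x y and s :: real
        assume x: "filterlim (\<lambda>n. R n \<bullet> x) at_top sequentially"
          and y: "filterlim (\<lambda>n. R n \<bullet> y) at_top sequentially" and s: "0 \<le> s" "s \<le> 1"
        show "filterlim (\<lambda>n. R n \<bullet> ((1 - s) *\<^sub>R x + s *\<^sub>R y)) at_top sequentially"
          unfolding filterlim_at_top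
        proof
          fix M :: real
          have "eventually (\<lambda>n. M \<le> R n \<bullet> x) sequentially" "eventually (\<lambda>n. M \<le> R n \<bullet> y) sequentially"
            using x y unfolding filterlim_at_top by auto
          then show "eventually (\<lambda>n. M \<le> R n \<bullet> ((1 - s) *\<^sub>R x + s *\<^sub>R y)) sequentially"
          proof eventually_elim
            case (elim n)
            have "(1 - s) * M + s * M \<le> (1 - s) * (R n \<bullet> x) + s * (R n \<bullet> y)"
              using elim s by (intro add_mono mult_left_mono) auto
            then show ?case by (simp add: inner_add_right algebra_simps)
          qed
        qed
      qed
      then have "convex hull P \<subseteq> {v. filterlim (\<lambda>n. R n \<bullet> v) at_top sequentially}"
        by (intro hull_minimal) (auto simp: P_def)
      then show ?thesis using that by blast
    qed
    have "span Z \<inter> convex hull P = {}"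
    proof (intro equals0I)
      fix v assume v: "v \<in> span Z \<inter> convex hull P"
      then obtain l where "(\<lambda>n. R n \<bullet> v) \<longlonglongrightarrow> l" using span unfolding convergent_def by blast
      then show False using top v not_tendsto_and_filterlim_at_infinity[OF sequentially_bot]
          filterlim_at_top_imp_at_infinity by blast
    qed
    then have "\<exists>p b. (\<forall>v\<in>span Z. p \<bullet> v < b) \<and> (\<forall>v\<in>convex hull P. b < p \<bullet> v)"
      using False fP by (intro separating_hyperplane_closed_compact)
        (auto simp: closed_span finite_imp_compact_convex_hull subspace_imp_convex)
    then obtain p b where pb: "\<And>v. v \<in> span Z \<Longrightarrow> p \<bullet> v < b" "\<And>v. v \<in> convex hull P \<Longrightarrow> b < p \<bullet> v"
      by blast
    have b: "0 < b" using pb(1)[OF span_zero] by simp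
    \<comment> \<open>A linear functional bounded above on a subspace vanishes there: otherwise some
      multiple of \<open>v\<close> would have the value \<open>b\<close>.\<close>
    have "p \<bullet> v = 0" if v: "v \<in> span Z" for v
    proof (rule ccontr)
      assume "p \<bullet> v \<noteq> 0"
      then have "p \<bullet> ((b / (p \<bullet> v)) *\<^sub>R v) = b" by simp
      then show False using pb(1)[OF span_scale[OF v]] by (metis less_irrefl)
    qed
    moreover have "0 < p \<bullet> u" if "u \<in> P" for u using pb(2)[OF hull_inc[OF that]] b by simp
    ultimately show ?thesis by blast
  qed (auto intro: exI[of _ 0])
  then obtain p where p: "\<And>v. v \<in> span Z \<Longrightarrow> p \<bullet> v = 0" "\<And>u. u \<in> P \<Longrightarrow> 0 < p \<bullet> u" by blast
  have top: "filterlim (\<lambda>n. (R n - \<alpha> n) \<bullet> u) at_top sequentially" if "u \<in> P" for u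
  proof -
    obtain l where "\<alpha> \<longlonglongrightarrow> l" using conv by (auto simp: convergent_def)
    then have "(\<lambda>n. - (\<alpha> n \<bullet> u)) \<longlonglongrightarrow> - (l \<bullet> u)" by (intro tendsto_intros)
    from filterlim_tendsto_add_at_top[OF this] that show ?thesis
      by (simp add: P_def inner_diff_left)
  qed
  \<comment> \<open>Since \<open>p\<close> separates the three alternatives by sign, the sign of
    \<open>p \<bullet> u\<close> determines which of them holds for \<open>u\<close>.\<close>
  have cases: "u \<in> Z \<or> u \<in> P \<or> - u \<in> P" if "u \<in> U" for u
    using tri[OF that] that by (auto simp: Z_def P_def)
  show ?thesis
  proof (rule that[OF r conv, of p])
    fix u assume u: "u \<in> U"
    show "(L (r n) - \<alpha> n) \<bullet> u = 0" if "p \<bullet> u = 0" for n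
      using cases[OF u] p(2)[of u] p(2)[of "- u"] that orth[OF span_base] by (auto simp: R_def)
    show "filterlim (\<lambda>n. (L (r n) - \<alpha> n) \<bullet> u) at_top sequentially" if "p \<bullet> u > 0"
      using cases[OF u] p(1)[OF span_base, of u] p(2)[of "- u"] that top[of u] by (auto simp: R_def)
    show "filterlim (\<lambda>n. (L (r n) - \<alpha> n) \<bullet> u) at_bot sequentially" if "p \<bullet> u < 0"
      using cases[OF u] p(1)[OF span_base, of u] p(2)[of u] that top[of "- u"]
      by (auto simp: R_def filterlim_uminus_at_bot)
  qed
qed

subsection \<open>Newton polyhedra and values at infinity\<close>

text \<open>Scalings are real even for complex coordinates. They change moduli only, when positive,
  and commute with conjugation, so mixed monomials are homogeneous too.\<close>

definition diag_scale :: "real ^ 'n::finite \<Rightarrow> 'a::real_vector ^ 'n \<Rightarrow> 'a ^ 'n" where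
  "diag_scale d x = (\<chi> i. d $ i *\<^sub>R x $ i)"

lemma diag_scale_nth [simp]: "diag_scale d x $ i = d $ i *\<^sub>R x $ i"
  by (simp add: diag_scale_def)

lemma linear_diag_scale: "linear (diag_scale d)"
  by (intro linearI) (simp_all add: vec_eq_iff scaleR_add_right)

lemma sum_axis: "(\<Sum>j\<in>UNIV. axis j (y $ j)) = (y :: 'a::comm_monoid_add ^ 'k::finite)"
  by (simp add: vec_eq_iff axis_def)

lemma linear_axis: "linear (axis j :: 'a::real_vector \<Rightarrow> 'a ^ 'k::finite)"
  by (intro linearI) (simp_all add: vec_eq_iff axis_def)

lemma bounded_linear_axis: "bounded_linear (axis j :: 'a::euclidean_space \<Rightarrow> 'a ^ 'k::finite)"
  using linear_axis linear_conv_bounded_linear by blast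

lemma vec_lambda_sum_axis: "(\<chi> j. g j) = (\<Sum>j\<in>UNIV. axis j (g j :: 'a::comm_monoid_add))"
  using sum_axis[of "\<chi> j. g j"] by simp

lemma has_derivative_vec_lambda:
  fixes g :: "'k::finite \<Rightarrow> 'v::real_normed_vector \<Rightarrow> 'a::euclidean_space"
  assumes "\<And>j. (g j has_derivative g' j) (at x)"
  shows "((\<lambda>x. \<chi> j. g j x) has_derivative (\<lambda>v. \<chi> j. g' j v)) (at x)"
  unfolding vec_lambda_sum_axis
  by (intro has_derivative_sum bounded_linear.has_derivative[OF bounded_linear_axis] assms)

lemma lipschitz_on_balls_vec_lambda:
  fixes g :: "'k::finite \<Rightarrow> 'v::real_normed_vector \<Rightarrow> 'a::euclidean_space"
  assumes "\<And>j. lipschitz_on_balls (g j)"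
  shows "lipschitz_on_balls (\<lambda>x. \<chi> j. g j x)"
  unfolding vec_lambda_sum_axis
  by (intro lipschitz_on_balls_sum lipschitz_on_balls_compose[OF lipschitz_on_balls_linear[OF bounded_linear_axis]] assms)

text \<open>Replacing the zero coordinates by \<open>1 / (n + 1)\<close> gives points converging to
  \<open>x\<close>. This moves points off the coordinate hyperplanes so that logarithms of their
  coordinates can be taken.\<close>

lemma open_has_nonzero_coordinates:
  fixes x :: "'a::real_normed_field ^ 'n::finite"
  assumes S: "open S" "x \<in> S"
  shows "\<exists>y\<in>S. \<forall>i. y $ i \<noteq> 0"
proof -
  let ?y = "\<lambda>n. \<chi> i. if x $ i = 0 then of_real (1 / real (Suc n)) else x $ i"
  have "?y \<longlonglongrightarrow> (\<chi> i. x $ i)"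
  proof (rule tendsto_vec_lambda)
    fix i
    have "(\<lambda>n. of_real (1 / real (Suc n)) :: 'a) \<longlonglongrightarrow> of_real 0"
      using LIMSEQ_Suc[OF lim_1_over_n] by (intro tendsto_of_real) simp
    then show "(\<lambda>n. if x $ i = 0 then of_real (1 / real (Suc n)) else x $ i) \<longlonglongrightarrow> x $ i"
      by (cases "x $ i = 0") auto
  qed
  then have "eventually (\<lambda>n. ?y n \<in> S) sequentially"
    using topological_tendstoD[OF _ S(1)] S(2) by simp
  then obtain n where "?y n \<in> S" by (auto simp: eventually_sequentially)
  then show ?thesis by (intro bexI[of _ "?y n"]) (simp_all del: of_nat_Suc)
qed

context
  fixes K :: "('m, 'n::finite, 'a::zero) monomials"
begin

lemma min_face_iff:
  assumes "v \<in> insert 0 (supp K f)"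
  shows "v \<in> min_face K f p \<longleftrightarrow> (\<forall>w\<in>insert 0 (supp K f). p \<bullet> v \<le> p \<bullet> w)"
  unfolding min_face_def using assms Gamma0_le_iff[of K f p v] by (auto simp: Gamma0_def hull_inc)

lemma min_vertex_exists:
  "\<exists>v\<in>insert 0 (supp K f). \<forall>w\<in>insert 0 (supp K f). p \<bullet> v \<le> p \<bullet> w"
proof -
  have "finite (insert 0 (supp K f))" by (simp add: supp_def)
  then obtain v where "v \<in> insert 0 (supp K f)" "\<forall>w\<in>insert 0 (supp K f). p \<bullet> v \<le> p \<bullet> w"
    by (metis arg_min_if_finite(1) arg_min_least insert_not_empty)
  then show ?thesis by blast
qed

end

text \<open>What the argument uses of monomials: homogeneity under real scalings and a locally
  Lipschitz differential. Ordinary and mixed polynomials are treated together on this basis.\<close>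

locale monomial_system =
  fixes K :: "('m, 'n::finite, 'a::{real_normed_field, euclidean_space}) monomials"
    and M' :: "'m \<Rightarrow> 'a ^ 'n \<Rightarrow> 'a ^ 'n \<Rightarrow> 'a"
  assumes homogeneous:
      "\<And>m d x. monom_fun K m (diag_scale d x) = (\<Prod>i\<in>UNIV. d $ i ^ (exponent K m $ i)) *\<^sub>R monom_fun K m x"
    and der_monom: "\<And>m x. (monom_fun K m has_derivative M' m x) (at x)"
    and lip_monom: "\<And>m. lipschitz_on_balls (monom_fun K m)"
    and lip_M': "\<And>m v. lipschitz_on_balls (\<lambda>x. M' m x v)"
begin

text \<open>Differentiate the homogeneity identity in \<open>x\<close> and compare the two
  derivatives.\<close>

lemma M'_scale: "M' m (diag_scale d x) (diag_scale d v) = (\<Prod>i\<in>UNIV. d $ i ^ (exponent K m $ i)) *\<^sub>R M' m x v"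
proof -
  have "(diag_scale d has_derivative diag_scale d) (at x)"
    using linear_imp_has_derivative[OF linear_diag_scale] .
  from diff_chain_at[OF this der_monom]
  have "((\<lambda>x. monom_fun K m (diag_scale d x)) has_derivative (\<lambda>v. M' m (diag_scale d x) (diag_scale d v))) (at x)"
    by (simp add: o_def)
  moreover have "((\<lambda>x. monom_fun K m (diag_scale d x)) has_derivative
      (\<lambda>v. (\<Prod>i\<in>UNIV. d $ i ^ (exponent K m $ i)) *\<^sub>R M' m x v)) (at x)"
    unfolding homogeneous by (intro has_derivative_scaleR_right der_monom)
  ultimately show ?thesis by (auto dest: has_derivative_unique simp: fun_eq_iff)
qed

definition part_der :: "('m \<Rightarrow>\<^sub>0 'a) \<Rightarrow> (real ^ 'n) set \<Rightarrow> 'a ^ 'n \<Rightarrow> 'a ^ 'n \<Rightarrow> 'a" where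
  "part_der f \<Delta> x v = (\<Sum>m | m \<in> Poly_Mapping.keys f \<and> real_point (exponent K m) \<in> \<Delta>.
     Poly_Mapping.lookup f m * M' m x v)"

lemma has_derivative_part: "(part_fun K f \<Delta> has_derivative part_der f \<Delta> x) (at x)"
  unfolding part_fun_def[abs_def] part_der_def[abs_def]
  by (intro has_derivative_sum has_derivative_mult_right der_monom)

lemma frechet_derivative_part: "frechet_derivative (part_fun K f \<Delta>) (at x) = part_der f \<Delta> x"
  using frechet_derivative_at[OF has_derivative_part] by simp

lemma poly_fun_eq: "poly_fun K f = part_fun K f UNIV"
  by (simp add: fun_eq_iff poly_fun_def part_fun_def)

lemma poly_map_eq: "poly_map K F = (\<lambda>x. \<chi> j. part_fun K (F j) UNIV x)"
  by (simp add: fun_eq_iff poly_map_def poly_fun_eq)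

definition map_der :: "('k::finite \<Rightarrow> 'm \<Rightarrow>\<^sub>0 'a) \<Rightarrow> 'a ^ 'n \<Rightarrow> 'a ^ 'n \<Rightarrow> 'a ^ 'k" where
  "map_der F x v = (\<chi> j. part_der (F j) UNIV x v)"

lemma has_derivative_poly_map: "(poly_map K F has_derivative map_der F x) (at x)"
  unfolding poly_map_eq map_der_def[abs_def] by (intro has_derivative_vec_lambda has_derivative_part)

lemma linear_map_der: "linear (map_der F x)"
  using has_derivative_poly_map has_derivative_linear by blast

lemma lip_poly_map: "lipschitz_on_balls (poly_map K F)"
  unfolding poly_map_eq part_fun_def
  by (intro lipschitz_on_balls_vec_lambda lipschitz_on_balls_sum
      lipschitz_on_balls_bilinear[OF bounded_bilinear_mult] lip_monom lipschitz_on_balls_const)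

lemma lip_map_der: "lipschitz_on_balls (\<lambda>x. map_der F x v)"
  unfolding map_der_def part_der_def
  by (intro lipschitz_on_balls_vec_lambda lipschitz_on_balls_sum
      lipschitz_on_balls_bilinear[OF bounded_bilinear_mult] lip_M' lipschitz_on_balls_const)

text \<open>Scaling by zero, with \<open>0 ^ 0 = 1\<close>, shows that a monomial vanishes at the
  origin unless its exponent is zero, and is constant in that case. So the part over
  \<open>{0}\<close> is the constant \<open>f 0\<close>.\<close>

lemma part_fun_origin:
  assumes "poly_fun K f 0 = 0"
  shows "part_fun K f {0} a = 0"
proof -
  have z: "monom_fun K m 0 = (if real_point (exponent K m) \<in> {0} then monom_fun K m a else 0)" for m
  proof -
    have "monom_fun K m (diag_scale 0 a) = (\<Prod>i\<in>UNIV. 0 ^ (exponent K m $ i)) *\<^sub>R monom_fun K m a"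
      by (simp only: homogeneous) simp
    moreover have "diag_scale 0 a = 0" by (simp add: vec_eq_iff)
    moreover have "real_point (exponent K m) \<in> {0} \<longleftrightarrow> (\<forall>i. exponent K m $ i = 0)"
      by (simp add: real_point_def vec_eq_iff)
    moreover have "(\<Prod>i\<in>UNIV. 0 ^ (exponent K m $ i) :: real) = (if \<forall>i. exponent K m $ i = 0 then 1 else 0)"
      by (auto simp: prod_zero_iff power_0_left)
    ultimately show ?thesis by auto
  qed
  have "poly_fun K f 0 = (\<Sum>m\<in>Poly_Mapping.keys f.
      if real_point (exponent K m) \<in> {0} then Poly_Mapping.lookup f m * monom_fun K m a else 0)"
    unfolding poly_fun_def by (intro sum.cong refl) (simp only: z, simp)
  also have "\<dots> = part_fun K f {0} a"
    unfolding part_fun_def by (subst sum.inter_filter[symmetric]) auto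
  finally show ?thesis using assms by simp
qed

text \<open>A nontrivial relation between the differentials at \<open>a\<close> is excluded by non-degeneracy unless it
  involves some \<open>j \<notin> I\<^sub>\<sigma>\<close>; then it makes \<open>a\<close> a singular point of \<open>F\<^sub>\<sigma>\<close>.\<close>

lemma limit_value:
  fixes F :: "'k::finite \<Rightarrow> 'm \<Rightarrow>\<^sub>0 'a" and \<omega> t :: "'a ^ 'k"
  assumes sub: "dual_subdivision K F \<C>" and nondeg: "nondegenerate_at_infinity K F \<C>"
    and F0: "poly_map K F 0 = 0" and p: "\<exists>i. p $ i < 0"
    and a: "\<And>i. a $ i \<noteq> 0" and \<omega>: "\<omega> \<noteq> 0"
    and rel: "\<And>v. (\<Sum>j\<in>UNIV. \<omega> $ j \<bullet> part_der (F j) (min_face K (F j) p) a v) = 0"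
    and I: "\<And>j. 0 \<notin> min_face K (F j) p \<Longrightarrow> part_fun K (F j) (min_face K (F j) p) a = 0"
    and Ic: "\<And>j. 0 \<in> min_face K (F j) p \<Longrightarrow> part_fun K (F j) (min_face K (F j) p) a = t $ j"
  shows "t \<in> N_set K F \<C> \<union> A_set K F \<C>"
proof -
  obtain \<sigma> where \<sigma>: "\<sigma> \<in> \<C>" "p \<in> \<sigma>"
    using sub p unfolding dual_subdivision_def partition_on_def by blast
  have face: "cone_face K F \<sigma> j = min_face K (F j) p" for j
    using cone_face_eq[OF sub \<sigma>] .
  have part: "cone_part K F \<sigma> j = part_fun K (F j) (min_face K (F j) p)" for j
    by (simp add: cone_part_def face fun_eq_iff)
  let ?I = "I_cone K F \<sigma>" and ?J = "J_cone K F \<sigma>"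
  have mI: "j \<in> ?I \<longleftrightarrow> 0 \<notin> min_face K (F j) p" for j by (simp add: I_cone_def face)
  have aG: "a \<in> G_cone K F \<sigma>" using a I by (auto simp: G_cone_def mI part)
  have der: "frechet_derivative (cone_part K F \<sigma> j) (at a) = part_der (F j) (min_face K (F j) p) a" for j
    unfolding part by (rule frechet_derivative_part)
  show ?thesis
  proof (cases "?J = {}")
    case False
    \<comment> \<open>Here the face is the origin, so \<open>t $ j\<close> is the constant term of
      the component.\<close>
    have "t $ j = 0" if "j \<in> ?J" for j
    proof -
      have eq: "min_face K (F j) p = {0}" using that by (simp add: J_cone_def face)
      have "poly_fun K (F j) 0 = 0" using F0 by (simp add: poly_map_def vec_eq_iff)
      then show ?thesis using Ic[of j] part_fun_origin[of "F j" a] by (simp add: eq)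
    qed
    then have "t \<in> N_set K F \<C>" using \<sigma>(1) False by (auto simp: N_set_def)
    then show ?thesis ..
  next
    case J: True
    \<comment> \<open>If \<open>\<omega>\<close> were supported in \<open>?I\<close>, non-degeneracy
      would give a \<open>v\<close> on which the differentials for \<open>?I\<close> take the values
      \<open>\<omega> $ j\<close>; the relation would then read
      \<open>\<bar>\<omega>\<bar>^2 = 0\<close>.\<close>
    have "\<exists>j. j \<notin> ?I \<and> \<omega> $ j \<noteq> 0"
    proof (rule ccontr)
      assume "\<not> ?thesis"
      then have z: "\<omega> $ j = 0" if "j \<notin> ?I" for j using that by blast
      have ne: "?I \<noteq> {}" using z \<omega> by (auto simp: vec_eq_iff)
      then have "a \<notin> Sing UNIV ?I (cone_part K F \<sigma>)"
        using nondeg \<sigma>(1) J aG unfolding nondegenerate_at_infinity_def by blast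
      then have "\<forall>y. \<exists>v. \<forall>j\<in>?I. frechet_derivative (cone_part K F \<sigma> j) (at a) v = y j"
        unfolding Sing_open[OF open_UNIV] by blast
      from spec[OF this, of "($) \<omega>"]
      obtain v where "\<forall>j\<in>?I. frechet_derivative (cone_part K F \<sigma> j) (at a) v = \<omega> $ j" ..
      then have v: "\<forall>j\<in>?I. part_der (F j) (min_face K (F j) p) a v = \<omega> $ j"
        by (simp only: der)
      have "\<omega> $ j \<bullet> part_der (F j) (min_face K (F j) p) a v = \<omega> $ j \<bullet> \<omega> $ j" for j
        using v z by (cases "j \<in> ?I") auto
      then have "(\<Sum>j\<in>UNIV. \<omega> $ j \<bullet> \<omega> $ j) = 0" using rel[of v] by simp
      then show False using \<omega> by (simp add: inner_vec_def[symmetric])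
    qed
    then obtain j0 where j0: "j0 \<notin> ?I" "\<omega> $ j0 \<noteq> 0" by blast
    \<comment> \<open>Otherwise some tangent vector \<open>v\<close> of \<open>G_cone\<close> has
      the values \<open>\<omega> $ j\<close> for \<open>j\<close> outside \<open>?I\<close>. The
      parts indexed by \<open>?I\<close> vanish along a curve in \<open>G_cone\<close> with velocity
      \<open>v\<close>, so their differentials kill \<open>v\<close>. The relation becomes a
      vanishing sum of squares that includes the one at \<open>j0\<close>.\<close>
    have "a \<in> Sing (G_cone K F \<sigma>) (- ?I) (cone_part K F \<sigma>)"
    proof (rule ccontr)
      assume "\<not> ?thesis"
      then have eq: "(\<lambda>v. \<lambda>j\<in>- ?I. frechet_derivative (cone_part K F \<sigma> j) (at a) v) ` tangent_space (G_cone K F \<sigma>) a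
          = (\<Pi>\<^sub>E j\<in>- ?I. UNIV)"
        using aG unfolding Sing_def by blast
      have "(\<lambda>j\<in>- ?I. \<omega> $ j) \<in> (\<Pi>\<^sub>E j\<in>- ?I. UNIV)" by auto
      from this[folded eq] obtain v where v: "v \<in> tangent_space (G_cone K F \<sigma>) a"
          "(\<lambda>j\<in>- ?I. \<omega> $ j) = (\<lambda>j\<in>- ?I. frechet_derivative (cone_part K F \<sigma> j) (at a) v)"
        by (rule imageE)
      obtain \<gamma> where \<gamma>: "\<gamma> 0 = a" "\<forall>\<^sub>F s in nhds 0. \<gamma> s \<in> G_cone K F \<sigma>"
          "(\<gamma> has_vector_derivative v) (at 0)" using v(1) unfolding tangent_space_def by blast
      have I0: "part_der (F j) (min_face K (F j) p) a v = 0" if "j \<in> ?I" for j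
      proof -
        let ?g = "cone_part K F \<sigma> j"
        have "((?g \<circ> \<gamma>) has_vector_derivative part_der (F j) (min_face K (F j) p) a v) (at 0)"
          using vector_derivative_diff_chain_within[OF \<gamma>(3) has_derivative_at_withinI[OF has_derivative_part]]
          unfolding part \<gamma>(1) by simp
        moreover have "((?g \<circ> \<gamma>) has_vector_derivative 0) (at 0)"
        proof -
          obtain S where S: "open S" "0 \<in> S" "\<forall>s\<in>S. \<gamma> s \<in> G_cone K F \<sigma>"
            using \<gamma>(2) unfolding eventually_nhds by blast
          have "0 = (?g \<circ> \<gamma>) s" if "s \<in> S" for s
            using S(3) that \<open>j \<in> ?I\<close> by (auto simp: G_cone_def)
          with S(1,2) show ?thesis
            by (intro has_vector_derivative_transform_within_open[OF has_vector_derivative_const])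
        qed
        ultimately show ?thesis by (rule vector_derivative_unique_at)
      qed
      have Ic0: "part_der (F j) (min_face K (F j) p) a v = \<omega> $ j" if "j \<notin> ?I" for j
        using fun_cong[OF v(2), of j] that by (simp add: der)
      have "(\<Sum>j\<in>UNIV. \<omega> $ j \<bullet> part_der (F j) (min_face K (F j) p) a v)
          = (\<Sum>j\<in>UNIV. if j \<in> ?I then 0 else \<omega> $ j \<bullet> \<omega> $ j)"
        by (intro sum.cong) (auto simp: I0 Ic0)
      then have "(\<Sum>j\<in>UNIV. if j \<in> ?I then 0 else \<omega> $ j \<bullet> \<omega> $ j) = 0" using rel[of v] by simp
      then have "(if j0 \<in> ?I then 0 else \<omega> $ j0 \<bullet> \<omega> $ j0) = 0"
        by (subst (asm) sum_nonneg_eq_0_iff) auto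
      then show False using j0 by simp
    qed
    then have "(\<lambda>j\<in>- ?I. cone_part K F \<sigma> j a) \<in> Disc (G_cone K F \<sigma>) (- ?I) (cone_part K F \<sigma>)"
      unfolding Disc_def by blast
    moreover have "(\<lambda>j\<in>- ?I. cone_part K F \<sigma> j a) = (\<lambda>j\<in>- ?I. t $ j)"
      using Ic by (auto simp: fun_eq_iff mI part)
    ultimately have "t \<in> A_set K F \<C>"
      using \<sigma>(1) J j0(1) unfolding A_set_def by auto
    then show ?thesis ..
  qed
qed

section \<open>Limits of sequences violating the Malgrange condition\<close>

lemma lip_adjoint: "lipschitz_on_balls (\<lambda>q. adjoint (map_der F (fst q)) (snd q))"
proof (rule lipschitz_on_balls_joint)
  show "linear (adjoint (map_der F x))" for x by (rule adjoint_linear[OF linear_map_der])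
  show "lipschitz_on_balls (\<lambda>x. adjoint (map_der F x) w)" for w
    unfolding adjoint_sum[OF linear_map_der]
    by (intro lipschitz_on_balls_sum lipschitz_on_balls_bilinear[OF bounded_bilinear_scaleR]
        lipschitz_on_balls_bilinear[OF bounded_bilinear_inner] lip_map_der lipschitz_on_balls_const)
qed

text \<open>A limit point \<open>(x, w)\<close> satisfies \<open>F x = t\<close> and
  \<open>dF(x)^* w = 0\<close> with \<open>\<bar>w\<bar> = 1\<close>, so \<open>w\<close> is
  orthogonal to the range of \<open>dF(x)\<close>.\<close>

lemma bounded_sequence_value:
  fixes X :: "nat \<Rightarrow> 'a ^ 'n" and W :: "nat \<Rightarrow> 'a ^ 'k::finite"
  assumes X: "bounded (range X)" and W: "\<And>n. norm (W n) = 1"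
    and t: "(\<lambda>n. poly_map K F (X n)) \<longlonglongrightarrow> t"
    and adj: "(\<lambda>n. adjoint (map_der F (X n)) (W n)) \<longlonglongrightarrow> 0"
  shows "t \<in> poly_map K F ` Sing_map (poly_map K F)"
proof -
  obtain B where B: "\<And>n. norm (X n) \<le> B" using X unfolding bounded_iff by auto
  have "norm (X n, W n) \<le> B + 1" for n
    using norm_Pair_le[of "X n" "W n"] B[of n] W[of n] by simp
  then have "bounded (range (\<lambda>n. (X n, W n)))" unfolding bounded_iff by auto
  then obtain l s where s: "strict_mono s" "((\<lambda>n. (X n, W n)) \<circ> s) \<longlonglongrightarrow> l"
    using bounded_imp_convergent_subsequence by blast
  define x w where "x = fst l" and "w = snd l"
  have lims: "(\<lambda>n. X (s n)) \<longlonglongrightarrow> x" "(\<lambda>n. W (s n)) \<longlonglongrightarrow> w"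
    using tendsto_fst[OF s(2)] tendsto_snd[OF s(2)] by (auto simp: o_def x_def w_def)
  have "norm w = 1" using LIMSEQ_unique[OF tendsto_norm[OF lims(2)]] by (simp add: W)
  have "(\<lambda>n. poly_map K F (X (s n))) \<longlonglongrightarrow> poly_map K F x"
    using continuous_on_tendsto_compose[OF lipschitz_on_balls_continuous[OF lip_poly_map] lims(1)] by simp
  then have x: "poly_map K F x = t"
    using LIMSEQ_unique LIMSEQ_subseq_LIMSEQ[OF t s(1)] by (auto simp: o_def)
  have "(\<lambda>n. adjoint (map_der F (X (s n))) (W (s n))) \<longlonglongrightarrow> adjoint (map_der F x) w"
    using continuous_on_tendsto_compose[OF lipschitz_on_balls_continuous[OF lip_adjoint] tendsto_Pair[OF lims]]
    by simp
  then have z: "adjoint (map_der F x) w = 0"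
    using LIMSEQ_unique LIMSEQ_subseq_LIMSEQ[OF adj s(1)] by (auto simp: o_def)
  have "\<not> surj (map_der F x)"
  proof
    assume "surj (map_der F x)"
    then obtain v where "map_der F x v = w" by (metis surjD)
    then have "w \<bullet> w = v \<bullet> adjoint (map_der F x) w" using adjoint_works[OF linear_map_der] by metis
    then show False using z \<open>norm w = 1\<close> by (simp add: dot_square_norm)
  qed
  then have "x \<in> Sing_map (poly_map K F)"
    using frechet_derivative_at[OF has_derivative_poly_map, of F x] by (simp add: Sing_map_def)
  then show ?thesis using x by blast
qed

text \<open>Pairing these vectors with logarithms of coordinates compares the sizes of two monomials
  of the same component. The origin takes part because it belongs to every
  \<open>Gamma0\<close>.\<close>

definition exponent_differences :: "('k::finite \<Rightarrow> 'm \<Rightarrow>\<^sub>0 'a) \<Rightarrow> (real ^ 'n) set" where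
  "exponent_differences F = (\<Union>j. (\<lambda>(u, w). u - w) ` (insert 0 (supp K (F j)) \<times> insert 0 (supp K (F j))))"

lemma finite_exponent_differences: "finite (exponent_differences F)"
  by (simp add: exponent_differences_def supp_def)

lemma exponent_differencesI:
  "u \<in> insert 0 (supp K (F j)) \<Longrightarrow> w \<in> insert 0 (supp K (F j)) \<Longrightarrow> u - w \<in> exponent_differences F"
  unfolding exponent_differences_def by blast

lemma prod_exp_power:
  "(\<Prod>i\<in>UNIV. (\<chi> i. exp (- (b $ i))) $ i ^ (e $ i)) = exp (- (real_point e \<bullet> b))"
  by (simp add: inner_vec_def real_point_def exp_sum exp_of_nat_mult[symmetric] sum_negf[symmetric] del: exp_minus)

text \<open>For \<open>x = diag_scale d A\<close>, a displacement scaled like the coordinates of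
  \<open>x\<close> costs at most \<open>\<bar>x\<bar>\<close> times a factor depending on
  \<open>v\<close> and \<open>A\<close>. This matches the weight \<open>\<bar>x\<bar>\<close> in the
  Malgrange condition.\<close>

lemma norm_diag_scale_le:
  fixes A v :: "'a ^ 'n"
  assumes d: "\<And>i. 0 < d $ i" and A: "\<And>i. A $ i \<noteq> 0"
  shows "norm (diag_scale d v) \<le> norm (diag_scale d A) * (\<Sum>i\<in>UNIV. norm (v $ i) / norm (A $ i))"
proof -
  have "norm (diag_scale d v) \<le> (\<Sum>i\<in>UNIV. norm (diag_scale d v $ i))"
    unfolding norm_vec_def by (rule L2_set_le_sum) simp
  also have "\<dots> = (\<Sum>i\<in>UNIV. norm (diag_scale d A $ i) * (norm (v $ i) / norm (A $ i)))"
    using A by (intro sum.cong) (simp_all add: field_simps)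
  also have "\<dots> \<le> (\<Sum>i\<in>UNIV. norm (diag_scale d A) * (norm (v $ i) / norm (A $ i)))"
    by (intro sum_mono mult_right_mono) (auto intro: Finite_Cartesian_Product.norm_nth_le simp del: diag_scale_nth)
  finally show ?thesis by (simp add: sum_distrib_left)
qed

text \<open>The scale \<open>D j n\<close> of the minimal face factors out of the
  \<open>j\<close>-th component and of its differential in scaled directions; what remains converges
  to the face part at \<open>a\<close> and its differential. The multipliers \<open>W\<close> times
  these scales, normalised, converge to the relation required by \<open>limit_value\<close>.\<close>

lemma scaled_sequence_value:
  fixes F :: "'k::finite \<Rightarrow> 'm \<Rightarrow>\<^sub>0 'a" and A :: "nat \<Rightarrow> 'a ^ 'n" and W :: "nat \<Rightarrow> 'a ^ 'k"
    and \<beta> :: "nat \<Rightarrow> real ^ 'n"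
  assumes sub: "dual_subdivision K F \<C>" and nondeg: "nondegenerate_at_infinity K F \<C>"
    and F0: "poly_map K F 0 = 0" and p: "\<exists>i. p $ i < 0"
    and A: "A \<longlonglongrightarrow> a" and An: "\<And>n i. A n $ i \<noteq> 0" and a: "\<And>i. a $ i \<noteq> 0"
    and W: "\<And>n. norm (W n) = 1"
    and \<beta>0: "\<And>u n. u \<in> exponent_differences F \<Longrightarrow> p \<bullet> u = 0 \<Longrightarrow> \<beta> n \<bullet> u = 0"
    and \<beta>1: "\<And>u. u \<in> exponent_differences F \<Longrightarrow> p \<bullet> u > 0 \<Longrightarrow> filterlim (\<lambda>n. \<beta> n \<bullet> u) at_top sequentially"
    and X: "\<And>n. X n = diag_scale (\<chi> i. exp (- (\<beta> n $ i))) (A n)"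
    and t: "(\<lambda>n. poly_map K F (X n)) \<longlonglongrightarrow> t"
    and adj: "(\<lambda>n. norm (X n) * norm (adjoint (map_der F (X n)) (W n))) \<longlonglongrightarrow> 0"
  shows "t \<in> N_set K F \<C> \<union> A_set K F \<C>"
proof -
  let ?S = "\<lambda>j. insert 0 (supp K (F j))"
  let ?e = "\<lambda>m. real_point (exponent K m)"
  define \<Delta> where "\<Delta> = (\<lambda>j. min_face K (F j) p)"
  define d where "d = (\<lambda>n. \<chi> i. exp (- (\<beta> n $ i)))"
  have "\<forall>j. \<exists>v. v \<in> ?S j \<and> (\<forall>w\<in>?S j. p \<bullet> v \<le> p \<bullet> w)"
    using min_vertex_exists[of K "F _" p] by blast
  then obtain vx where "\<forall>j. vx j \<in> ?S j \<and> (\<forall>w\<in>?S j. p \<bullet> vx j \<le> p \<bullet> w)"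
    using choice[of "\<lambda>j v. v \<in> ?S j \<and> (\<forall>w\<in>?S j. p \<bullet> v \<le> p \<bullet> w)"] by blast
  then have vx: "\<And>j. vx j \<in> ?S j" "\<And>j w. w \<in> ?S j \<Longrightarrow> p \<bullet> vx j \<le> p \<bullet> w" by blast+
  \<comment> \<open>\<open>D\<close> is the size of the monomials on the minimal face, read off at a
    minimiser \<open>vx j\<close>; \<open>R\<close> is the size of a monomial relative to it, with
    limit one on the face and zero off it.\<close>
  define D where "D = (\<lambda>j n. exp (- (vx j \<bullet> \<beta> n)))"
  define R where "R = (\<lambda>j m n. exp (- (\<beta> n \<bullet> (?e m - vx j))))"
  have mem\<Delta>: "w \<in> \<Delta> j \<longleftrightarrow> p \<bullet> (w - vx j) = 0" if "w \<in> ?S j" for w j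
    using vx(1)[of j] vx(2)[of _ j] that unfolding \<Delta>_def min_face_iff[OF that] inner_diff_right by (smt (verit))
  have eS: "?e m \<in> ?S j" if "m \<in> Poly_Mapping.keys (F j)" for m j
    using that by (auto simp: supp_def)
  have Xd: "X n = diag_scale (d n) (A n)" for n by (simp add: X d_def)
  have edI: "v \<in> ?S j \<Longrightarrow> w \<in> ?S j \<Longrightarrow> v - w \<in> exponent_differences F" for v w j
    by (rule exponent_differencesI)
  have DR: "(\<Prod>i\<in>UNIV. d n $ i ^ (exponent K m $ i)) = D j n * R j m n" for n m j
    unfolding d_def prod_exp_power D_def R_def
    by (simp add: exp_add[symmetric] inner_diff_right inner_commute)
  have Rlim: "R j m \<longlonglongrightarrow> (if ?e m \<in> \<Delta> j then 1 else 0)" if m: "m \<in> Poly_Mapping.keys (F j)" for j m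
  proof (cases "?e m \<in> \<Delta> j")
    case True
    then have "R j m = (\<lambda>n. 1)"
      using \<beta>0[OF edI[OF eS[OF m] vx(1)[of j]]] mem\<Delta>[OF eS[OF m]]
      by (simp add: R_def)
    then show ?thesis using True by simp
  next
    case False
    then have "0 < p \<bullet> (?e m - vx j)"
      using vx(2)[OF eS[OF m]] mem\<Delta>[OF eS[OF m]] by (simp add: inner_diff_right)
    from \<beta>1[OF edI[OF eS[OF m] vx(1)[of j]] this]
    have "filterlim (\<lambda>n. - (\<beta> n \<bullet> (?e m - vx j))) at_bot sequentially"
      by (simp add: filterlim_uminus_at_bot)
    from filterlim_compose[OF exp_at_bot this] show ?thesis using False by (simp add: R_def)
  qed
  have comb: "(\<lambda>n. \<Sum>m\<in>Poly_Mapping.keys (F j). Poly_Mapping.lookup (F j) m * (R j m n *\<^sub>R h m (A n)))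
      \<longlonglongrightarrow> (\<Sum>m | m \<in> Poly_Mapping.keys (F j) \<and> ?e m \<in> \<Delta> j. Poly_Mapping.lookup (F j) m * h m a)"
    if h: "\<And>m. continuous_on UNIV (h m)" for j and h :: "'m \<Rightarrow> 'a ^ 'n \<Rightarrow> 'a"
  proof -
    have "(\<lambda>n. \<Sum>m\<in>Poly_Mapping.keys (F j). Poly_Mapping.lookup (F j) m * (R j m n *\<^sub>R h m (A n)))
      \<longlonglongrightarrow> (\<Sum>m\<in>Poly_Mapping.keys (F j). Poly_Mapping.lookup (F j) m * ((if ?e m \<in> \<Delta> j then 1 else 0) *\<^sub>R h m a))"
      using continuous_on_tendsto_compose[OF h A] by (intro tendsto_intros Rlim) auto
    also have "(\<Sum>m\<in>Poly_Mapping.keys (F j). Poly_Mapping.lookup (F j) m * ((if ?e m \<in> \<Delta> j then 1 else 0) *\<^sub>R h m a))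
        = (\<Sum>m\<in>Poly_Mapping.keys (F j). if ?e m \<in> \<Delta> j then Poly_Mapping.lookup (F j) m * h m a else 0)"
      by (intro sum.cong) auto
    also have "\<dots> = (\<Sum>m | m \<in> Poly_Mapping.keys (F j) \<and> ?e m \<in> \<Delta> j. Poly_Mapping.lookup (F j) m * h m a)"
      by (subst sum.inter_filter[symmetric]) auto
    finally show ?thesis .
  qed
  define \<Phi> where "\<Phi> = (\<lambda>j n. \<Sum>m\<in>Poly_Mapping.keys (F j). Poly_Mapping.lookup (F j) m * (R j m n *\<^sub>R monom_fun K m (A n)))"
  define \<Psi> where "\<Psi> = (\<lambda>v j n. \<Sum>m\<in>Poly_Mapping.keys (F j). Poly_Mapping.lookup (F j) m * (R j m n *\<^sub>R M' m (A n) v))"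
  have \<Phi>: "\<Phi> j \<longlonglongrightarrow> part_fun K (F j) (\<Delta> j) a" for j
    unfolding \<Phi>_def part_fun_def by (intro comb lipschitz_on_balls_continuous lip_monom)
  have \<Psi>: "\<Psi> v j \<longlonglongrightarrow> part_der (F j) (\<Delta> j) a v" for v j
    unfolding \<Psi>_def part_der_def by (intro comb lipschitz_on_balls_continuous lip_M')
  have f: "poly_map K F (X n) $ j = D j n *\<^sub>R \<Phi> j n" for j n
    unfolding Xd poly_map_def poly_fun_def \<Phi>_def homogeneous DR[of n _ j]
    by (simp add: scaleR_sum_right)
  have f': "map_der F (X n) (diag_scale (d n) v) $ j = D j n *\<^sub>R \<Psi> v j n" for j n v
    unfolding Xd map_der_def part_der_def \<Psi>_def M'_scale DR[of n _ j]
    by (simp add: scaleR_sum_right)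
  \<comment> \<open>A face containing the origin has \<open>p \<bullet> vx j = 0\<close>, and the
    exact vanishing in \<open>\<beta>0\<close> makes its scale equal to one. Otherwise
    \<open>p \<bullet> vx j < 0\<close> and the scale tends to infinity.\<close>
  have D0: "D j n = 1" if "0 \<in> \<Delta> j" for j n
    using \<beta>0[OF edI[OF _ vx(1)], of 0 j n] mem\<Delta>[of 0 j] that
    by (simp add: D_def inner_commute)
  have Dtop: "filterlim (D j) at_top sequentially" if "0 \<notin> \<Delta> j" for j
  proof -
    have "0 < p \<bullet> (0 - vx j)" using vx(2)[of 0 j] mem\<Delta>[of 0 j] that by simp
    from \<beta>1[OF edI[OF _ vx(1)] this]
    have "filterlim (\<lambda>n. - (vx j \<bullet> \<beta> n)) at_top sequentially" by (simp add: inner_commute)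
    from filterlim_compose[OF exp_at_top this] show ?thesis by (simp add: D_def)
  qed
  have D1: "eventually (\<lambda>n. 1 \<le> D j n) sequentially" for j
    using D0[of j] Dtop[of j] by (cases "0 \<in> \<Delta> j") (auto simp: filterlim_at_top)
  have Dpos: "0 < D j n" for j n by (simp add: D_def)
  have tj: "(\<lambda>n. D j n *\<^sub>R \<Phi> j n) \<longlonglongrightarrow> t $ j" for j
    using tendsto_vec_nth[OF t, of j] by (simp add: f)
  \<comment> \<open>The multipliers absorb the scales. Eventually all scales are at least one, so
    \<open>\<bar>\<Omega> n\<bar> \<ge> 1\<close> and normalising does not enlarge the
    error.\<close>
  define \<Omega> where "\<Omega> = (\<lambda>n. \<chi> j. D j n *\<^sub>R W n $ j)"
  have \<Omega>ne: "\<Omega> n \<noteq> 0" for n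
  proof
    assume "\<Omega> n = 0"
    then have "W n = 0" using Dpos less_imp_neq by (fastforce simp: \<Omega>_def vec_eq_iff)
    then show False using W[of n] by simp
  qed
  have \<Omega>1: "eventually (\<lambda>n. 1 \<le> norm (\<Omega> n)) sequentially"
  proof -
    have "eventually (\<lambda>n. \<forall>j. 1 \<le> D j n) sequentially"
      using D1 by (intro eventually_all_finite)
    then show ?thesis
    proof eventually_elim
      case (elim n)
      have "norm (W n) \<le> norm (\<Omega> n)"
        unfolding norm_vec_def
      proof (rule L2_set_mono)
        show "norm (W n $ j) \<le> norm (\<Omega> n $ j)" for j
          using elim[rule_format, of j] mult_right_mono[of 1 "D j n" "norm (W n $ j)"] by (simp add: \<Omega>_def)
      qed simp
      then show ?case by (simp add: W)
    qed
  qed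
  define \<Omega>1 where "\<Omega>1 = (\<lambda>n. \<Omega> n /\<^sub>R norm (\<Omega> n))"
  have n1: "norm (\<Omega>1 n) = 1" for n using \<Omega>ne by (simp add: \<Omega>1_def)
  then have "bounded (range \<Omega>1)" unfolding bounded_iff by (auto intro: exI[of _ 1])
  then obtain \<omega> s where s: "strict_mono s" "(\<Omega>1 \<circ> s) \<longlonglongrightarrow> \<omega>"
    using bounded_imp_convergent_subsequence by blast
  have \<omega>: "\<omega> \<noteq> 0" using LIMSEQ_unique[OF tendsto_norm[OF s(2)], of 1] by (auto simp: n1 o_def)
  have rel: "(\<Sum>j\<in>UNIV. \<omega> $ j \<bullet> part_der (F j) (\<Delta> j) a v) = 0" for v
  proof -
    \<comment> \<open>\<open>?\<rho> n\<close> is the approximate relation: the adjoint paired with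
      \<open>diag_scale (d n) v\<close>, divided by \<open>\<bar>\<Omega> n\<bar>\<close>. The
      factor \<open>?c\<close> converges because the coordinates of \<open>a\<close> are nonzero,
      and \<open>?q\<close> tends to zero by \<open>adj\<close>.\<close>
    let ?\<rho> = "\<lambda>n. \<Sum>j\<in>UNIV. \<Omega>1 n $ j \<bullet> \<Psi> v j n"
    let ?c = "\<lambda>n. \<Sum>i\<in>UNIV. norm (v $ i) / norm (A n $ i)"
    let ?q = "\<lambda>n. norm (X n) * norm (adjoint (map_der F (X n)) (W n))"
    have eq: "?\<rho> n = (diag_scale (d n) v \<bullet> adjoint (map_der F (X n)) (W n)) / norm (\<Omega> n)" for n
    proof -
      have "diag_scale (d n) v \<bullet> adjoint (map_der F (X n)) (W n) = map_der F (X n) (diag_scale (d n) v) \<bullet> W n"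
        by (rule adjoint_works[OF linear_map_der])
      also have "\<dots> = (\<Sum>j\<in>UNIV. \<Omega> n $ j \<bullet> \<Psi> v j n)"
        unfolding inner_vec_def f' by (simp add: \<Omega>_def inner_commute)
      finally show ?thesis by (simp add: \<Omega>1_def sum_divide_distrib divide_inverse sum_distrib_left mult.commute)
    qed
    have "eventually (\<lambda>n. norm (?\<rho> n) \<le> ?c n * ?q n) sequentially"
      using \<Omega>1
    proof eventually_elim
      case (elim n)
      have "norm (?\<rho> n) \<le> norm (diag_scale (d n) v \<bullet> adjoint (map_der F (X n)) (W n))"
        unfolding eq using elim \<Omega>ne[of n] by (simp add: divide_le_eq mult_le_cancel_left1 mult_left_le)
      also have "\<dots> \<le> norm (diag_scale (d n) v) * norm (adjoint (map_der F (X n)) (W n))"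
        by (simp add: Cauchy_Schwarz_ineq2)
      also have "\<dots> \<le> (norm (X n) * ?c n) * norm (adjoint (map_der F (X n)) (W n))"
        unfolding Xd using An by (intro mult_right_mono norm_diag_scale_le) (auto simp: d_def)
      finally show ?case by (simp add: mult_ac)
    qed
    moreover have "(\<lambda>n. ?c n * ?q n) \<longlonglongrightarrow> (\<Sum>i\<in>UNIV. norm (v $ i) / norm (a $ i)) * 0"
      using a by (intro tendsto_intros adj A) auto
    ultimately have "?\<rho> \<longlonglongrightarrow> 0" by (intro Lim_null_comparison[of ?\<rho> "\<lambda>n. ?c n * ?q n"]) simp_all
    from LIMSEQ_subseq_LIMSEQ[OF this s(1)] have "(\<lambda>n. ?\<rho> (s n)) \<longlonglongrightarrow> 0" by (simp add: o_def)
    moreover have "(\<lambda>n. ?\<rho> (s n)) \<longlonglongrightarrow> (\<Sum>j\<in>UNIV. \<omega> $ j \<bullet> part_der (F j) (\<Delta> j) a v)"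
    proof (intro tendsto_intros)
      show "(\<lambda>n. \<Omega>1 (s n)) \<longlonglongrightarrow> \<omega>" using s(2) by (simp add: o_def)
      show "(\<lambda>n. \<Psi> v j (s n)) \<longlonglongrightarrow> part_der (F j) (\<Delta> j) a v" for j
        using LIMSEQ_subseq_LIMSEQ[OF \<Psi> s(1)] by (simp add: o_def)
    qed
    ultimately show ?thesis by (rule LIMSEQ_unique[symmetric])
  qed
  show ?thesis
  proof (rule limit_value[OF sub nondeg F0 p a \<omega>, folded \<Delta>_def])
    show "(\<Sum>j\<in>UNIV. \<omega> $ j \<bullet> part_der (F j) (min_face K (F j) p) a v) = 0" for v
      using rel by (simp add: \<Delta>_def)
    fix j
    show "part_fun K (F j) (min_face K (F j) p) a = 0" if "0 \<notin> min_face K (F j) p"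
    proof -
      \<comment> \<open>The component itself converges to \<open>t $ j\<close> while its scale tends
        to infinity, so the rescaled component tends to zero.\<close>
      have "(\<lambda>n. inverse (D j n)) \<longlonglongrightarrow> 0"
        using that by (intro tendsto_inverse_0_at_top Dtop) (simp add: \<Delta>_def)
      from tendsto_scaleR[OF this tj[of j]] have "\<Phi> j \<longlonglongrightarrow> 0" using Dpos less_imp_neq[OF Dpos] by simp
      then show ?thesis using LIMSEQ_unique[OF \<Phi>] by (simp add: \<Delta>_def)
    qed
    show "part_fun K (F j) (min_face K (F j) p) a = t $ j" if "0 \<in> min_face K (F j) p"
    proof -
      have "\<Phi> j \<longlonglongrightarrow> t $ j" using tj[of j] D0[of j] that by (simp add: \<Delta>_def)
      then show ?thesis using LIMSEQ_unique[OF \<Phi>] by (simp add: \<Delta>_def)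
    qed
  qed
qed

text \<open>One \<open>\<epsilon>\<close> is both radius and constant, so failure at
  \<open>\<epsilon> = 1 / (n + 1)\<close> for all \<open>n\<close> produces a single sequence whose
  values tend to \<open>t\<close>.\<close>

lemma malgrange_condition:
  fixes F :: "'k::finite \<Rightarrow> 'm \<Rightarrow>\<^sub>0 'a"
  assumes sub: "dual_subdivision K F \<C>" and nondeg: "nondegenerate_at_infinity K F \<C>"
    and F0: "poly_map K F 0 = 0"
    and t: "t \<notin> poly_map K F ` Sing_map (poly_map K F) \<union> N_set K F \<C> \<union> A_set K F \<C>"
  shows "\<exists>\<epsilon>>0. \<forall>x w. norm (poly_map K F x - t) < \<epsilon> \<longrightarrow>
    \<epsilon> * norm w \<le> (1 + norm x) * norm (adjoint (map_der F x) w)"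
proof (rule ccontr)
  assume neg: "\<not> ?thesis"
  \<comment> \<open>Once \<open>w\<close> is normalised, both strict inequalities are open in
    \<open>x\<close>, so \<open>x\<close> can be moved off the coordinate hyperplanes.\<close>
  have ex: "\<exists>x w. (\<forall>i. x $ i \<noteq> 0) \<and> norm w = 1 \<and> norm (poly_map K F x - t) < \<epsilon> \<and>
      (1 + norm x) * norm (adjoint (map_der F x) w) < \<epsilon>" if \<epsilon>: "\<epsilon> > 0" for \<epsilon>
  proof -
    obtain x w where xw: "norm (poly_map K F x - t) < \<epsilon>"
        "(1 + norm x) * norm (adjoint (map_der F x) w) < \<epsilon> * norm w"
      using neg \<epsilon> by (meson not_le)
    have "0 \<le> (1 + norm x) * norm (adjoint (map_der F x) w)" by simp
    then have w: "0 < norm w" using xw(2) \<epsilon> by (metis le_less_trans zero_less_mult_pos)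
    define w1 where "w1 = w /\<^sub>R norm w"
    let ?g = "\<lambda>y. (1 + norm y) * norm (adjoint (map_der F y) w1)"
    have "?g x = (1 + norm x) * norm (adjoint (map_der F x) w) / norm w"
      using w by (simp add: w1_def linear_cmul[OF adjoint_linear[OF linear_map_der]] divide_inverse)
    also have "\<dots> < \<epsilon>" using xw(2) w by (simp add: divide_less_eq)
    finally have gx: "?g x < \<epsilon>" .
    have "continuous_on UNIV (\<lambda>q. adjoint (map_der F (fst q)) (snd q))"
      by (rule lipschitz_on_balls_continuous[OF lip_adjoint])
    from continuous_on_compose2[OF this, of UNIV "\<lambda>y. (y, w1)"]
    have adj: "continuous_on UNIV (\<lambda>y. adjoint (map_der F y) w1)"
      by (simp add: continuous_on_Pair)
    have "open {y. norm (poly_map K F y - t) < \<epsilon> \<and> ?g y < \<epsilon>}"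
      by (intro open_Collect_conj open_Collect_less continuous_intros adj
          lipschitz_on_balls_continuous lip_poly_map)
    from open_has_nonzero_coordinates[OF this, of x] xw(1) gx
    obtain y where "\<forall>i. y $ i \<noteq> 0" "norm (poly_map K F y - t) < \<epsilon>" "?g y < \<epsilon>" by auto
    moreover have "norm w1 = 1" using w by (simp add: w1_def)
    ultimately show ?thesis by blast
  qed
  have "\<exists>x w. (\<forall>i. x $ i \<noteq> 0) \<and> norm w = 1 \<and> norm (poly_map K F x - t) < 1 / real (Suc n) \<and>
      (1 + norm x) * norm (adjoint (map_der F x) w) < 1 / real (Suc n)" for n
    by (rule ex) simp
  then obtain Y V where YV: "\<And>n i. Y n $ i \<noteq> 0" "\<And>n. norm (V n) = 1"
      "\<And>n. norm (poly_map K F (Y n) - t) < 1 / real (Suc n)"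
      "\<And>n. (1 + norm (Y n)) * norm (adjoint (map_der F (Y n)) (V n)) < 1 / real (Suc n)"
    by metis
  have Yt: "(\<lambda>n. poly_map K F (Y n)) \<longlonglongrightarrow> t"
  proof (rule Lim_null[THEN iffD2, OF Lim_null_comparison[OF _ LIMSEQ_Suc[OF lim_1_over_n]]])
    show "\<forall>\<^sub>F n in sequentially. norm (poly_map K F (Y n) - t) \<le> 1 / real (Suc n)"
      using YV(3) by (intro always_eventually allI less_imp_le)
  qed
  have Yadj: "(\<lambda>n. (1 + norm (Y n)) * norm (adjoint (map_der F (Y n)) (V n))) \<longlonglongrightarrow> 0"
  proof (rule Lim_null_comparison[OF _ LIMSEQ_Suc[OF lim_1_over_n]])
    show "\<forall>\<^sub>F n in sequentially. norm ((1 + norm (Y n)) * norm (adjoint (map_der F (Y n)) (V n)))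
        \<le> 1 / real (Suc n)"
      using YV(4) by (intro always_eventually allI) (simp add: abs_mult less_imp_le)
  qed
  \<comment> \<open>The axes are included so that \<open>p $ i\<close> also controls the size of the
    single coordinate \<open>i\<close>.\<close>
  define U where "U = exponent_differences F \<union> range (\<lambda>i. axis i (1::real))"
  have "finite U" by (simp add: U_def finite_exponent_differences)
  \<comment> \<open>With the minus sign, coordinates with \<open>p $ i > 0\<close> tend to zero, and
    the dominant monomials are those minimising \<open>p\<close>, as in the definition of the
    faces.\<close>
  then obtain r p \<alpha> where r: "strict_mono r" and \<alpha>: "convergent \<alpha>"
    and dir: "\<And>u n. u \<in> U \<Longrightarrow> p \<bullet> u = 0 \<Longrightarrow> ((\<chi> i. - ln (norm (Y (r n) $ i))) - \<alpha> n) \<bullet> u = 0"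
      "\<And>u. u \<in> U \<Longrightarrow> p \<bullet> u > 0 \<Longrightarrow>
        filterlim (\<lambda>n. ((\<chi> i. - ln (norm (Y (r n) $ i))) - \<alpha> n) \<bullet> u) at_top sequentially"
    by (rule asymptotic_direction[where L = "\<lambda>n. \<chi> i. - ln (norm (Y n $ i))"]) blast
  define X W where "X = (\<lambda>n. Y (r n))" and "W = (\<lambda>n. V (r n))"
  define \<beta> where "\<beta> = (\<lambda>n. (\<chi> i. - ln (norm (X n $ i))) - \<alpha> n)"
  have dir: "u \<in> U \<Longrightarrow> p \<bullet> u = 0 \<Longrightarrow> \<beta> n \<bullet> u = 0"
      "u \<in> U \<Longrightarrow> p \<bullet> u > 0 \<Longrightarrow> filterlim (\<lambda>n. \<beta> n \<bullet> u) at_top sequentially" for u n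
    using dir unfolding \<beta>_def X_def by blast+
  have X0: "X n $ i \<noteq> 0" and W: "norm (W n) = 1" for n i using YV(1,2) by (auto simp: X_def W_def)
  have Xt: "(\<lambda>n. poly_map K F (X n)) \<longlonglongrightarrow> t"
    using LIMSEQ_subseq_LIMSEQ[OF Yt r] by (simp add: o_def X_def)
  have Xadj: "(\<lambda>n. (1 + norm (X n)) * norm (adjoint (map_der F (X n)) (W n))) \<longlonglongrightarrow> 0"
    using LIMSEQ_subseq_LIMSEQ[OF Yadj r] by (simp add: o_def X_def W_def)
  have normX: "norm (X n $ i) = exp (- (\<beta> n $ i)) * exp (- (\<alpha> n $ i))" for n i
    using X0[of n i] by (simp add: \<beta>_def exp_add[symmetric])
  obtain \<alpha>l where \<alpha>l: "\<alpha> \<longlonglongrightarrow> \<alpha>l" using \<alpha> by (auto simp: convergent_def)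
  show False
  proof (cases "\<exists>i. p $ i < 0")
    case False
    \<comment> \<open>Without negative entries in \<open>p\<close>, every
      \<open>\<beta> n $ i\<close> is eventually nonnegative, so the modulus of each coordinate is
      at most \<open>exp (- (\<alpha> n $ i))\<close>, which is bounded.\<close>
    have "Bseq X"
    proof (rule Bseq_eq_bounded[THEN iffD2])
      have ev: "\<forall>\<^sub>F n in sequentially. 0 \<le> \<beta> n $ i" for i
      proof -
        have u: "axis i 1 \<in> U" by (simp add: U_def)
        have "0 \<le> p $ i" using False by (simp add: not_less)
        then consider "p \<bullet> axis i 1 = 0" | "p \<bullet> axis i 1 > 0"
          by (cases "p $ i = 0") (simp_all add: inner_axis order_less_le)
        then show ?thesis
        proof cases
          case 1
          then show ?thesis using dir(1)[OF u] by (simp add: inner_axis)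
        next
          case 2
          then show ?thesis using dir(2)[OF u] by (simp add: inner_axis filterlim_at_top)
        qed
      qed
      obtain B where B: "\<And>n. norm (\<alpha> n) \<le> B"
        using convergent_imp_Bseq[OF \<alpha>] unfolding Bseq_def by auto
      have "\<forall>\<^sub>F n in sequentially. \<forall>i. 0 \<le> \<beta> n $ i" using ev by (rule eventually_all_finite)
      then have "\<forall>\<^sub>F n in sequentially. norm (X n) \<le> (\<Sum>i\<in>(UNIV :: 'n set). exp B)"
      proof eventually_elim
        case (elim n)
        have "norm (X n) \<le> (\<Sum>i\<in>UNIV. norm (X n $ i))"
          unfolding norm_vec_def by (rule L2_set_le_sum) simp
        also have "\<dots> \<le> (\<Sum>i\<in>(UNIV :: 'n set). exp B)"
        proof (rule sum_mono)
          fix i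
          have "- (\<alpha> n $ i) \<le> B"
            using Finite_Cartesian_Product.norm_nth_le[of "\<alpha> n" i] B[of n] by simp
          then show "norm (X n $ i) \<le> exp B"
            unfolding normX exp_add[symmetric] using elim[rule_format, of i] by simp
        qed
        finally show ?case .
      qed
      then show "bounded (range X)" unfolding Bseq_eq_bounded[symmetric] by (rule BfunI)
    qed
    then have bX: "bounded (range X)" unfolding Bseq_eq_bounded .
    have "(\<lambda>n. adjoint (map_der F (X n)) (W n)) \<longlonglongrightarrow> 0"
    proof (rule Lim_null_comparison[OF _ Xadj])
      show "\<forall>\<^sub>F n in sequentially. norm (adjoint (map_der F (X n)) (W n))
          \<le> (1 + norm (X n)) * norm (adjoint (map_der F (X n)) (W n))"
        by (intro always_eventually allI) (simp add: distrib_right)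
    qed
    from bounded_sequence_value[OF bX W Xt this] show False using t by blast
  next
    case True
    \<comment> \<open>The rescaled points keep the arguments of the coordinates, while their moduli
      become \<open>exp (- (\<alpha> n $ i))\<close>. Convergence of \<open>\<alpha>\<close> keeps
      these away from zero and infinity.\<close>
    define A where "A = (\<lambda>n. \<chi> i. exp (\<beta> n $ i) *\<^sub>R X n $ i)"
    have XA: "X n = diag_scale (\<chi> i. exp (- (\<beta> n $ i))) (A n)" for n
      by (simp add: vec_eq_iff A_def exp_add[symmetric])
    have normA: "norm (A n $ i) = exp (- (\<alpha> n $ i))" for n i
      by (simp add: A_def normX exp_add[symmetric])
    obtain B where B: "\<And>n. norm (\<alpha> n) \<le> B"
      using convergent_imp_Bseq[OF \<alpha>] unfolding Bseq_def by auto
    have "norm (A n) \<le> (\<Sum>i\<in>(UNIV :: 'n set). exp B)" for n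
    proof -
      have "norm (A n) \<le> (\<Sum>i\<in>UNIV. norm (A n $ i))"
        unfolding norm_vec_def by (rule L2_set_le_sum) simp
      also have "\<dots> \<le> (\<Sum>i\<in>(UNIV :: 'n set). exp B)"
      proof (rule sum_mono)
        show "norm (A n $ i) \<le> exp B" for i
          using Finite_Cartesian_Product.norm_nth_le[of "\<alpha> n" i] B[of n] by (simp add: normA)
      qed
      finally show ?thesis .
    qed
    then have "bounded (range A)" unfolding bounded_iff by blast
    then obtain a s where s: "strict_mono s" "(A \<circ> s) \<longlonglongrightarrow> a"
      using bounded_imp_convergent_subsequence by blast
    have a: "a $ i \<noteq> 0" for i
    proof -
      have "(\<lambda>n. exp (- (\<alpha> (s n) $ i))) \<longlonglongrightarrow> exp (- (\<alpha>l $ i))"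
        using LIMSEQ_subseq_LIMSEQ[OF \<alpha>l s(1)] by (intro tendsto_intros) (simp add: o_def)
      moreover have "(\<lambda>n. exp (- (\<alpha> (s n) $ i))) \<longlonglongrightarrow> norm (a $ i)"
        using tendsto_norm[OF tendsto_vec_nth[OF s(2), of i]] by (simp add: o_def normA)
      ultimately have "norm (a $ i) = exp (- (\<alpha>l $ i))" by (rule LIMSEQ_unique[symmetric])
      then show ?thesis by auto
    qed
    have "t \<in> N_set K F \<C> \<union> A_set K F \<C>"
    proof (rule scaled_sequence_value[OF sub nondeg F0 True s(2) _ a, where W = "W \<circ> s" and X = "X \<circ> s" and \<beta> = "\<beta> \<circ> s"])
      show "(A \<circ> s) n $ i \<noteq> 0" for n i using X0 by (simp add: A_def)
      show "norm ((W \<circ> s) n) = 1" for n using W by simp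
      show "(\<beta> \<circ> s) n \<bullet> u = 0" if "u \<in> exponent_differences F" "p \<bullet> u = 0" for n u
        using dir(1) that by (simp add: U_def)
      show "filterlim (\<lambda>n. (\<beta> \<circ> s) n \<bullet> u) at_top sequentially"
        if "u \<in> exponent_differences F" "p \<bullet> u > 0" for u
        using filterlim_compose[OF dir(2)[of u] filterlim_subseq[OF s(1)]] that by (simp add: U_def o_def)
      show "(X \<circ> s) n = diag_scale (\<chi> i. exp (- ((\<beta> \<circ> s) n $ i))) ((A \<circ> s) n)" for n
        using XA[of "s n"] by simp
      show "(\<lambda>n. poly_map K F ((X \<circ> s) n)) \<longlonglongrightarrow> t"
        using LIMSEQ_subseq_LIMSEQ[OF Xt s(1)] by (simp add: o_def)
      have "(\<lambda>n. norm (X n) * norm (adjoint (map_der F (X n)) (W n))) \<longlonglongrightarrow> 0"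
      proof (rule Lim_null_comparison[OF _ Xadj])
        show "\<forall>\<^sub>F n in sequentially. norm (norm (X n) * norm (adjoint (map_der F (X n)) (W n)))
            \<le> (1 + norm (X n)) * norm (adjoint (map_der F (X n)) (W n))"
          by (intro always_eventually allI) (simp add: distrib_right)
      qed
      from LIMSEQ_subseq_LIMSEQ[OF this s(1)]
      show "(\<lambda>n. norm ((X \<circ> s) n) * norm (adjoint (map_der F ((X \<circ> s) n)) ((W \<circ> s) n))) \<longlonglongrightarrow> 0"
        by (simp add: o_def)
    qed
    then show False using t by blast
  qed
qed

text \<open>\<open>F\<close> is locally trivial over an open ball around \<open>t\<close>;
  minimality then puts the bifurcation locus into the closed complement of that ball.\<close>

theorem bifurcation_locus_subset:
  fixes F :: "'k::finite \<Rightarrow> 'm \<Rightarrow>\<^sub>0 'a"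
  assumes sub: "dual_subdivision K F \<C>" and nondeg: "nondegenerate_at_infinity K F \<C>"
    and F0: "poly_map K F 0 = 0"
  shows "bifurcation_locus (poly_map K F)
    \<subseteq> poly_map K F ` Sing_map (poly_map K F) \<union> N_set K F \<C> \<union> A_set K F \<C>"
proof (rule subsetI, rule ccontr)
  let ?F = "poly_map K F"
  fix t assume t: "t \<in> bifurcation_locus ?F"
    "t \<notin> ?F ` Sing_map ?F \<union> N_set K F \<C> \<union> A_set K F \<C>"
  obtain \<epsilon> where \<epsilon>: "0 < \<epsilon>" "\<And>x w. norm (?F x - t) < \<epsilon> \<Longrightarrow>
      \<epsilon> * norm w \<le> (1 + norm x) * norm (adjoint (map_der F x) w)"
    using malgrange_condition[OF sub nondeg F0 t(2)] by blast
  have "locally_trivial_fibration_over ?F (ball t \<epsilon>)"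
    unfolding locally_trivial_fibration_over_def
  proof
    fix z assume z: "z \<in> ball t \<epsilon>"
    \<comment> \<open>The condition at \<open>t\<close> passes to every \<open>z\<close> of the
      ball, with the same constant and the radius reduced by the distance.\<close>
    define \<delta> where "\<delta> = \<epsilon> - dist t z"
    have \<delta>: "0 < \<delta>" using z by (simp add: \<delta>_def)
    have near: "dist t y < \<epsilon>" if "dist z y < \<delta>" for y
      using dist_triangle[of t y z] that by (simp add: \<delta>_def)
    interpret malgrange ?F "map_der F" z \<delta> \<epsilon>
    proof
      show "\<epsilon> * norm w \<le> (1 + norm x) * norm (adjoint (map_der F x) w)" if "norm (?F x - z) < \<delta>" for x w
        using \<epsilon>(2)[of x] near[of "?F x"] that by (simp add: dist_norm norm_minus_commute)
    qed (use has_derivative_poly_map lip_map_der lip_poly_map \<delta> \<epsilon>(1) in auto)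
    have "ball z (\<delta> / 2) \<subseteq> ball t \<epsilon>" using near \<delta> by auto
    then have "openin (top_of_set (ball t \<epsilon>)) (ball z (\<delta> / 2))" by (simp add: open_subset)
    moreover have "z \<in> ball z (\<delta> / 2)" using \<delta> by simp
    ultimately show "\<exists>U h h'. openin (top_of_set (ball t \<epsilon>)) U \<and> z \<in> U \<and>
        homeomorphism (?F -` U) (U \<times> ?F -` {z}) h h' \<and> (\<forall>x\<in>?F -` U. fst (h x) = ?F x)"
      using trivial_near by blast
  qed
  then have "bifurcation_locus ?F \<subseteq> - ball t \<epsilon>"
    by (intro bifurcation_locus_minimal(3)) (auto simp: closed_Compl)
  then show False using t(1) \<epsilon>(1) by auto
qed

end

section \<open>The real, complex and mixed monomials\<close>

definition c1_lipschitz :: "('v::real_normed_vector \<Rightarrow> 'w::real_normed_vector) \<Rightarrow> bool" where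
  "c1_lipschitz f \<longleftrightarrow> lipschitz_on_balls f \<and>
     (\<exists>f'. (\<forall>x. (f has_derivative f' x) (at x)) \<and> (\<forall>v. lipschitz_on_balls (\<lambda>x. f' x v)))"

lemma c1_lipschitz_const: "c1_lipschitz (\<lambda>x. c)"
  unfolding c1_lipschitz_def
  by (intro conjI exI[of _ "\<lambda>x v. 0"] allI lipschitz_on_balls_const has_derivative_const)

lemma c1_lipschitz_linear:
  assumes "bounded_linear f"
  shows "c1_lipschitz f"
  unfolding c1_lipschitz_def
  by (intro conjI exI[of _ "\<lambda>x. f"] allI lipschitz_on_balls_const lipschitz_on_balls_linear assms
      bounded_linear_imp_has_derivative)

text \<open>The product rule mixes values and derivatives, which is why the class requires both to
  be Lipschitz on balls.\<close>

lemma c1_lipschitz_mult: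
  fixes f g :: "'v::real_normed_vector \<Rightarrow> 'a::real_normed_algebra"
  assumes "c1_lipschitz f" "c1_lipschitz g"
  shows "c1_lipschitz (\<lambda>x. f x * g x)"
proof -
  obtain f' g' where f: "lipschitz_on_balls f" "\<And>x. (f has_derivative f' x) (at x)"
      "\<And>v. lipschitz_on_balls (\<lambda>x. f' x v)"
    and g: "lipschitz_on_balls g" "\<And>x. (g has_derivative g' x) (at x)"
      "\<And>v. lipschitz_on_balls (\<lambda>x. g' x v)"
    using assms unfolding c1_lipschitz_def by blast
  show ?thesis
    unfolding c1_lipschitz_def
    by (intro conjI exI[of _ "\<lambda>x v. f x * g' x v + f' x v * g x"] allI has_derivative_mult f g
        lipschitz_on_balls_add lipschitz_on_balls_bilinear[OF bounded_bilinear_mult])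
qed

lemma c1_lipschitz_power:
  fixes f :: "'v::real_normed_vector \<Rightarrow> 'a::real_normed_field"
  assumes "c1_lipschitz f"
  shows "c1_lipschitz (\<lambda>x. f x ^ n)"
  by (induction n) (auto intro: c1_lipschitz_const c1_lipschitz_mult assms)

lemma c1_lipschitz_prod:
  fixes f :: "'i \<Rightarrow> 'v::real_normed_vector \<Rightarrow> 'a::real_normed_field"
  assumes "\<And>i. i \<in> I \<Longrightarrow> c1_lipschitz (f i)"
  shows "c1_lipschitz (\<lambda>x. \<Prod>i\<in>I. f i x)"
  using assms
  by (induction I rule: infinite_finite_induct) (auto intro: c1_lipschitz_const c1_lipschitz_mult)

lemma monomial_system_exists:
  fixes K :: "('m, 'n::finite, 'a::{real_normed_field, euclidean_space}) monomials"
  assumes "\<And>m d x. monom_fun K m (diag_scale d x) = (\<Prod>i\<in>UNIV. d $ i ^ (exponent K m $ i)) *\<^sub>R monom_fun K m x"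
    and "\<And>m. c1_lipschitz (monom_fun K m)"
  shows "\<exists>M'. monomial_system K M'"
proof -
  have "\<forall>m. \<exists>f'. (\<forall>x. (monom_fun K m has_derivative f' x) (at x)) \<and> (\<forall>v. lipschitz_on_balls (\<lambda>x. f' x v))"
    using assms(2) unfolding c1_lipschitz_def by blast
  then obtain M' where "\<forall>m. (\<forall>x. (monom_fun K m has_derivative M' m x) (at x)) \<and>
      (\<forall>v. lipschitz_on_balls (\<lambda>x. M' m x v))" by metis
  then have "monomial_system K M'"
    using assms unfolding c1_lipschitz_def by unfold_locales blast+
  then show ?thesis by (rule exI[of "monomial_system K" M'])
qed

lemma monomial_system_ordinary:
  "\<exists>M'. monomial_system (ordinary :: (nat ^ 'n, 'n::finite, 'a::{real_normed_field, euclidean_space}) monomials) M'"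
proof (rule monomial_system_exists)
  fix m :: "nat ^ 'n" and d and x :: "'a ^ 'n"
  show "monom_fun ordinary m (diag_scale d x)
      = (\<Prod>i\<in>UNIV. d $ i ^ (exponent (ordinary :: (_, _, 'a) monomials) m $ i)) *\<^sub>R monom_fun ordinary m x"
    by (simp add: ordinary_def scaleR_conv_of_real power_mult_distrib prod.distrib)
next
  show "c1_lipschitz (monom_fun (ordinary :: (_, 'n, 'a) monomials) m)" for m
    by (simp add: ordinary_def)
      (intro c1_lipschitz_prod c1_lipschitz_power c1_lipschitz_linear bounded_linear_vec_nth)
qed

text \<open>Real scalings pass through conjugation, so the two exponents add up; conjugation is real
  linear, so the monomials are smooth over the reals.\<close>

lemma monomial_system_mixed:
  "\<exists>M'. monomial_system (mixed :: ((nat ^ 'n) \<times> (nat ^ 'n), 'n::finite, complex) monomials) M'"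
proof (rule monomial_system_exists)
  fix m :: "(nat ^ 'n) \<times> (nat ^ 'n)" and d and x :: "complex ^ 'n"
  show "monom_fun mixed m (diag_scale d x)
      = (\<Prod>i\<in>UNIV. d $ i ^ (exponent mixed m $ i)) *\<^sub>R monom_fun mixed m x"
    by (cases m) (simp add: mixed_def scaleR_conv_of_real power_mult_distrib prod.distrib power_add mult_ac)
next
  show "c1_lipschitz (monom_fun (mixed :: (_, 'n, _) monomials) m)" for m
    by (cases m) (simp add: mixed_def,
      intro c1_lipschitz_prod c1_lipschitz_mult c1_lipschitz_power c1_lipschitz_linear
        bounded_linear_vec_nth bounded_linear_compose[OF bounded_linear_cnj bounded_linear_vec_nth])
qed

lemma bifurcation_locus_subset:
  assumes "\<exists>M'. monomial_system K M'" "dual_subdivision K F \<C>" "nondegenerate_at_infinity K F \<C>"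
    "poly_map K F 0 = 0"
  shows "bifurcation_locus (poly_map K F)
    \<subseteq> poly_map K F ` Sing_map (poly_map K F) \<union> N_set K F \<C> \<union> A_set K F \<C>"
  using assms monomial_system.bifurcation_locus_subset by blast

theorem corollary1p2:
  assumes "CARD('k::finite) \<le> CARD('n::finite)"
  shows
    "(\<forall>(F :: 'k \<Rightarrow> nat ^ 'n \<Rightarrow>\<^sub>0 real) \<C>.
        (\<forall>j. \<not> poly_fun ordinary (F j) constant_on UNIV) \<and>
        depends_on_all_vars ordinary F \<and>
        poly_map ordinary F 0 = 0 \<and>
        dual_subdivision ordinary F \<C> \<and>
        nondegenerate_at_infinity ordinary F \<C> \<longrightarrow>
        bifurcation_locus (poly_map ordinary F)
          \<subseteq> poly_map ordinary F ` Sing_map (poly_map ordinary F) \<union> N_set ordinary F \<C> \<union> A_set ordinary F \<C>) \<and>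
     (\<forall>(F :: 'k \<Rightarrow> nat ^ 'n \<Rightarrow>\<^sub>0 complex) \<C>.
        (\<forall>j. \<not> poly_fun ordinary (F j) constant_on UNIV) \<and>
        depends_on_all_vars ordinary F \<and>
        poly_map ordinary F 0 = 0 \<and>
        dual_subdivision ordinary F \<C> \<and>
        nondegenerate_at_infinity ordinary F \<C> \<longrightarrow>
        bifurcation_locus (poly_map ordinary F)
          \<subseteq> poly_map ordinary F ` Sing_map (poly_map ordinary F) \<union> N_set ordinary F \<C> \<union> A_set ordinary F \<C>) \<and>
     (\<forall>(F :: 'k \<Rightarrow> (nat ^ 'n) \<times> (nat ^ 'n) \<Rightarrow>\<^sub>0 complex) \<C>.
        (\<forall>j. \<not> poly_fun mixed (F j) constant_on UNIV) \<and>
        depends_on_all_vars mixed F \<and>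
        poly_map mixed F 0 = 0 \<and>
        dual_subdivision mixed F \<C> \<and>
        nondegenerate_at_infinity mixed F \<C> \<longrightarrow>
        bifurcation_locus (poly_map mixed F)
          \<subseteq> poly_map mixed F ` Sing_map (poly_map mixed F) \<union> N_set mixed F \<C> \<union> A_set mixed F \<C>)"
  by (intro conjI allI impI; elim conjE;
      rule bifurcation_locus_subset[OF monomial_system_ordinary]
        bifurcation_locus_subset[OF monomial_system_mixed]; assumption)

end
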